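(* Let $\Phi$ be an irreducible crystallographic root system of rank $\ell$, $m\ge1$ and $0\le k\le\ell$. The number $f^+_{k-1}(\Phi,m)$ equals each of: (i) the number of pairs $(R,S)$ where $R$ is a dominant region of $\mathcal A^m_\Phi$ and $S$ is a set of $\ell-k$ walls of $R$ of the form $H_{\alpha,m}$ which separate $R$ from $A_\circ$, such that $S$ contains every such wall of $R$ with $\alpha\in\Pi$; (ii) the number of pairs $(\mathcal I,T)$ where $\mathcal I$ is a geometric chain of filters in $\Phi^+$ of length $m$ and $T$ is a set of $\ell-k$ roots indecomposable of rank $m$ with respect to $\mathcal I$ which contains all simple roots that are indecomposable of rank $m$ with respect to $\mathcal I$.
   Context: $\Phi$ spans Euclidean $V$; positive system $\Phi^+$, simple roots $\Pi=\{\sigma_i\}$, highest root $\tilde\alpha$. $\mathcal A^m_\Phi$: hyperplanes $H_{\alpha,k}=\{x:(\alpha,x)=k\}$, $\alpha\in\Phi$, $0\le k\le m$; dominant = inside $\{(\alpha,x)>0\ \forall\alpha\in\Phi^+\}$; $A_\circ=\{x:(\sigma_i,x)>0,(\tilde\alpha,x)<1\}$; walls support facets of closures; separate = different open half-spaces. $h^+_i(\Phi,m)$ is the number of bounded dominant regions with exactly $\ell-i$ walls of the form $H_{\alpha,m}$ not separating $R$ from $A_\circ$, and $\sum_{i=0}^\ell f^+_{i-1}(\Phi,m)(x-1)^{\ell-i}=\sum_{i=0}^\ell h^+_i(\Phi,m)x^{\ell-i}$. Root poset: $\alpha\le\beta$ iff $\beta-\alpha$ is a nonnegative combination of positive roots;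 filters are up-closed. A geometric chain of filters of length $m$ is $\Phi^+=\mathcal I_0\supseteq\cdots\supseteq\mathcal I_m$ (filters) with $(\mathcal J_i+\mathcal J_j)\cap\Phi^+\subseteq\mathcal J_{i+j}$ for $i+j\le m$ where $\mathcal J_i=\Phi^+\setminus\mathcal I_i$, and $(\mathcal I_i+\mathcal I_j)\cap\Phi^+\subseteq\mathcal I_{i+j}$ for all $i,j\ge0$ with $\mathcal I_i=\mathcal I_m$ for $i>m$; $\alpha$ is indecomposable of rank $m$ if $\alpha\in\mathcal I_m$ and $\alpha\ne\beta+\gamma$ whenever $\beta\in\mathcal I_i,\gamma\in\mathcal I_j$, $i,j\ge0$, $i+j=m$. *)

theory Defs
  imports "HOL-Analysis.Analysis"
begin

definition reflection :: "'a::euclidean_space \<Rightarrow> 'a \<Rightarrow> 'a" where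
  "reflection \<alpha> x = x - ((2 * inner x \<alpha>) / inner \<alpha> \<alpha>) *\<^sub>R \<alpha>"

definition crystallographic_root_system :: "'a::euclidean_space set \<Rightarrow> bool" where
  "crystallographic_root_system \<Phi> \<longleftrightarrow>
     finite \<Phi> \<and> 0 \<notin> \<Phi> \<and> span \<Phi> = UNIV \<and>
     (\<forall>\<alpha>\<in>\<Phi>. \<forall>c::real. c *\<^sub>R \<alpha> \<in> \<Phi> \<longrightarrow> c = 1 \<or> c = -1) \<and>
     (\<forall>\<alpha>\<in>\<Phi>. \<forall>\<beta>\<in>\<Phi>. reflection \<alpha> \<beta> \<in> \<Phi>) \<and>
     (\<forall>\<alpha>\<in>\<Phi>. \<forall>\<beta>\<in>\<Phi>. (2 * inner \<beta> \<alpha>) / inner \<alpha> \<alpha> \<in> \<int>)"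

definition irreducible_root_system :: "'a::euclidean_space set \<Rightarrow> bool" where
  "irreducible_root_system \<Phi> \<longleftrightarrow>
     crystallographic_root_system \<Phi> \<and>
     \<not> (\<exists>\<Phi>1 \<Phi>2. \<Phi>1 \<noteq> {} \<and> \<Phi>2 \<noteq> {} \<and> \<Phi>1 \<union> \<Phi>2 = \<Phi> \<and> \<Phi>1 \<inter> \<Phi>2 = {} \<and>
            (\<forall>\<alpha>\<in>\<Phi>1. \<forall>\<beta>\<in>\<Phi>2. inner \<alpha> \<beta> = 0))"

definition positive_system :: "'a::euclidean_space set \<Rightarrow> 'a set \<Rightarrow> bool" where
  "positive_system \<Phi> \<Phi>p \<longleftrightarrow>
     (\<exists>v. (\<forall>\<alpha>\<in>\<Phi>. inner v \<alpha> \<noteq> 0) \<and> \<Phi>p = {\<alpha>\<in>\<Phi>. inner v \<alpha> > 0})"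

definition simple_roots :: "'a::euclidean_space set \<Rightarrow> 'a set" where
  "simple_roots \<Phi>p = {\<alpha>\<in>\<Phi>p. \<not> (\<exists>\<beta>\<in>\<Phi>p. \<exists>\<gamma>\<in>\<Phi>p. \<alpha> = \<beta> + \<gamma>)}"

definition root_le :: "'a::euclidean_space set \<Rightarrow> 'a \<Rightarrow> 'a \<Rightarrow> bool" where
  "root_le \<Phi>p \<alpha> \<beta> \<longleftrightarrow>
     (\<exists>c::'a \<Rightarrow> real. (\<forall>\<gamma>\<in>\<Phi>p. c \<gamma> \<ge> 0) \<and> \<beta> - \<alpha> = (\<Sum>\<gamma>\<in>\<Phi>p. c \<gamma> *\<^sub>R \<gamma>))"

definition highest_root :: "'a::euclidean_space set \<Rightarrow> 'a" where
  "highest_root \<Phi>p = (THE \<alpha>. \<alpha> \<in> \<Phi>p \<and> (\<forall>\<beta>\<in>\<Phi>p. root_le \<Phi>p \<beta> \<alpha>))"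

definition hyp :: "'a::euclidean_space \<Rightarrow> real \<Rightarrow> 'a set" where
  "hyp \<alpha> k = {x. inner \<alpha> x = k}"

definition arrangement :: "'a::euclidean_space set \<Rightarrow> nat \<Rightarrow> 'a set set" where
  "arrangement \<Phi> m = {hyp \<alpha> (real k) | \<alpha> k. \<alpha> \<in> \<Phi> \<and> k \<le> m}"

definition regions :: "'a::euclidean_space set \<Rightarrow> nat \<Rightarrow> 'a set set" where
  "regions \<Phi> m = components (UNIV - \<Union>(arrangement \<Phi> m))"

definition dominant :: "'a::euclidean_space set \<Rightarrow> 'a set \<Rightarrow> bool" where
  "dominant \<Phi>p R \<longleftrightarrow> R \<subseteq> {x. \<forall>\<alpha>\<in>\<Phi>p. inner \<alpha> x > 0}"

definition fundamental_alcove :: "'a::euclidean_space set \<Rightarrow> 'a set" where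
  "fundamental_alcove \<Phi>p =
     {x. (\<forall>\<sigma>\<in>simple_roots \<Phi>p. inner \<sigma> x > 0) \<and> inner (highest_root \<Phi>p) x < 1}"

definition is_wall :: "'a::euclidean_space set \<Rightarrow> nat \<Rightarrow> 'a set \<Rightarrow> 'a set \<Rightarrow> bool" where
  "is_wall \<Phi> m R H \<longleftrightarrow>
     H \<in> arrangement \<Phi> m \<and> aff_dim (H \<inter> closure R) = int DIM('a) - 1"

definition separates :: "'a::euclidean_space set \<Rightarrow> 'a set \<Rightarrow> 'a set \<Rightarrow> bool" where
  "separates H A B \<longleftrightarrow>
     (\<exists>a b. a \<noteq> 0 \<and> H = {x. inner a x = b} \<and>
        ((A \<subseteq> {x. inner a x < b} \<and> B \<subseteq> {x. inner a x > b}) \<or>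
         (A \<subseteq> {x. inner a x > b} \<and> B \<subseteq> {x. inner a x < b})))"

definition h_plus :: "'a::euclidean_space set \<Rightarrow> 'a set \<Rightarrow> nat \<Rightarrow> nat \<Rightarrow> nat" where
  "h_plus \<Phi> \<Phi>p m i =
     card {R \<in> regions \<Phi> m. bounded R \<and> dominant \<Phi>p R \<and>
        card {H. is_wall \<Phi> m R H \<and> (\<exists>\<alpha>\<in>\<Phi>. H = hyp \<alpha> (real m)) \<and>
                 \<not> separates H R (fundamental_alcove \<Phi>p)} = DIM('a) - i}"

text \<open>\<open>f_plus \<Phi> \<Phi>p m i\<close> stands for \<open>f\<^sup>+\<^sub>i\<^sub>-\<^sub>1(\<Phi>,m)\<close>, \<open>0 \<le> i \<le> \<ell>\<close>, defined by the identity
  \<open>\<Sum>\<^sub>i f\<^sup>+\<^sub>i\<^sub>-\<^sub>1 (x-1)^(\<ell>-i) = \<Sum>\<^sub>i h\<^sup>+\<^sub>i x^(\<ell>-i)\<close>.\<close>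
definition f_plus :: "'a::euclidean_space set \<Rightarrow> 'a set \<Rightarrow> nat \<Rightarrow> nat \<Rightarrow> int" where
  "f_plus \<Phi> \<Phi>p m =
     (THE f. (\<forall>i>DIM('a). f i = 0) \<and>
        (\<forall>x::real. (\<Sum>i\<le>DIM('a). of_int (f i) * (x - 1) ^ (DIM('a) - i)) =
                   (\<Sum>i\<le>DIM('a). of_nat (h_plus \<Phi> \<Phi>p m i) * x ^ (DIM('a) - i))))"

definition root_filter :: "'a::euclidean_space set \<Rightarrow> 'a set \<Rightarrow> bool" where
  "root_filter \<Phi>p I \<longleftrightarrow> I \<subseteq> \<Phi>p \<and> (\<forall>\<alpha>\<in>I. \<forall>\<beta>\<in>\<Phi>p. root_le \<Phi>p \<alpha> \<beta> \<longrightarrow> \<beta> \<in> I)"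

definition setsum :: "'a::ab_group_add set \<Rightarrow> 'a set \<Rightarrow> 'a set" where
  "setsum A B = {a + b | a b. a \<in> A \<and> b \<in> B}"

text \<open>A geometric chain of filters of length \<open>m\<close>, represented as \<open>I :: nat \<Rightarrow> _\<close> with the
  convention \<open>I i = I m\<close> for \<open>i > m\<close>.\<close>
definition geometric_chain :: "'a::euclidean_space set \<Rightarrow> nat \<Rightarrow> (nat \<Rightarrow> 'a set) \<Rightarrow> bool" where
  "geometric_chain \<Phi>p m I \<longleftrightarrow>
     I 0 = \<Phi>p \<and> (\<forall>i\<le>m. root_filter \<Phi>p (I i)) \<and> (\<forall>i<m. I (Suc i) \<subseteq> I i) \<and>
     (\<forall>i>m. I i = I m) \<and>
     (\<forall>i j. i + j \<le> m \<longrightarrow> setsum (\<Phi>p - I i) (\<Phi>p - I j) \<inter> \<Phi>p \<subseteq> \<Phi>p - I (i + j)) \<and>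
     (\<forall>i j. setsum (I i) (I j) \<inter> \<Phi>p \<subseteq> I (i + j))"

definition indecomposable :: "'a::euclidean_space set \<Rightarrow> nat \<Rightarrow> (nat \<Rightarrow> 'a set) \<Rightarrow> 'a \<Rightarrow> bool" where
  "indecomposable \<Phi>p m I \<alpha> \<longleftrightarrow>
     \<alpha> \<in> I m \<and> (\<forall>i j \<beta> \<gamma>. i + j = m \<longrightarrow> \<beta> \<in> I i \<longrightarrow> \<gamma> \<in> I j \<longrightarrow> \<alpha> \<noteq> \<beta> + \<gamma>)"

end

theory Submission
  imports Defs
begin

text \<open>
  Both counts reduce to the same data: a dominant region is the set of points with
  \<open>(\<alpha>, x) > i\<close> for \<open>\<alpha> \<in> I\<^sub>i\<close> and \<open>(\<alpha>, x) < i\<close> otherwise, for a geometric chain \<open>I\<close>. That every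
  geometric chain occurs is a feasibility question for strict linear inequalities. By Gordan's
  alternative and a rounding argument, infeasibility yields two multisets of positive roots with the
  same sum but contradictory levels; such a relation is shortened, down to nothing, by subtracting a
  root on one side from a root on the other with which it has positive inner product.

  The walls \<open>H\<^sub>\<alpha>\<^sub>,\<^sub>m\<close> separating a region from the fundamental alcove then correspond to the
  indecomposable roots of rank \<open>m\<close>, and the nonseparating ones to those roots whose addition to
  \<open>I\<^sub>m\<close> leaves a geometric chain. Any set of such walls can be crossed simultaneously, in either
  direction, by changing only \<open>I\<^sub>m\<close>. Boundedness means that \<open>I\<^sub>m\<close> contains no simple root, so crossing
  turns pairs of a bounded region and a set of nonseparating walls, which
  \<open>f\<^sup>+\<close> counts by the binomial theorem, into pairs of an arbitrary dominant region and a set of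
  separating walls containing all simple ones.
\<close>

text \<open>Let \<open>u \<alpha>\<close> be the largest \<open>i \<le> m\<close> with
  \<open>\<alpha> \<in> I i\<close>. The two sum conditions on a chain give \<open>min m (u \<beta>
  + u \<gamma>) \<le> u (\<beta> + \<gamma>) \<le> u \<beta> + u \<gamma> + 1\<close>. A point of
  the region must satisfy \<open>u \<alpha> < (\<alpha>, x)\<close>, and
  \<open>(\<alpha>, x) < u \<alpha> + 1\<close> only if \<open>u \<alpha> < m\<close>. This
  truncation is the obstacle: roots of level \<open>m\<close> have no upper bound, so only roots of
  smaller level may stand on the upper side of a relation, and shortening has to preserve that.
  Shortening removes whole roots, hence the need for integral weights; integrality is tested by
  pairing with coroots.

  Several walls can be crossed at once because the conditions for crossing one of them mention the
  original chain only and survive the other changes of \<open>I m\<close>. Irreducibility enters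
  through the highest root, which places the fundamental alcove below level 1 for every positive
  root. The roots of nonseparating walls are linearly independent, so there are at most as many as
  the rank, and every bounded region is counted by exactly one \<open>h_plus\<close>.\<close>

section \<open>Convexity and linear dependence\<close>

text \<open>Splitting a relation by the sign of its coefficients writes one vector \<open>z\<close>
  both over \<open>P\<close> and over \<open>N\<close>. Obtuseness gives
  \<open>inner z z \<le> 0\<close>, so \<open>z = 0\<close>, and pairing with \<open>v\<close>,
  which is positive on \<open>S\<close>, then kills every coefficient.\<close>

lemma independent_obtuse:
  fixes S :: "'a::euclidean_space set"
  assumes fin: "finite S" and pos: "\<And>s. s \<in> S \<Longrightarrow> inner v s > 0"
    and obt: "\<And>s t. s \<in> S \<Longrightarrow> t \<in> S \<Longrightarrow> s \<noteq> t \<Longrightarrow> inner s t \<le> 0"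
  shows "independent S"
proof -
  have "u s = 0" if u: "(\<Sum>s\<in>S. u s *\<^sub>R s) = 0" and s: "s \<in> S" for u s
  proof -
    define P where "P = {s\<in>S. u s > 0}"
    define N where "N = {s\<in>S. u s \<le> 0}"
    define z where "z = (\<Sum>s\<in>P. u s *\<^sub>R s)"
    have fP: "finite P" "finite N" "S = P \<union> N" "P \<inter> N = {}" "P \<subseteq> S" "N \<subseteq> S"
      using fin by (auto simp: P_def N_def)
    have "z + (\<Sum>s\<in>N. u s *\<^sub>R s) = 0"
      using u fP sum.union_disjoint[of P N "\<lambda>s. u s *\<^sub>R s"] by (simp add: z_def)
    then have z2: "z = (\<Sum>s\<in>N. (- u s) *\<^sub>R s)"
      by (simp add: sum_negf eq_neg_iff_add_eq_0)
    have "inner z z = (\<Sum>s\<in>P. \<Sum>t\<in>N. u s * (- u t) * inner s t)"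
    proof -
      have "inner z z = inner (\<Sum>s\<in>P. u s *\<^sub>R s) (\<Sum>t\<in>N. (- u t) *\<^sub>R t)"
        by (subst (2) z2, subst z_def) (rule refl)
      also have "\<dots> = (\<Sum>s\<in>P. \<Sum>t\<in>N. inner (u s *\<^sub>R s) ((- u t) *\<^sub>R t))"
        by (simp only: inner_sum_left, simp only: inner_sum_right)
      finally show ?thesis by (simp add: mult_ac)
    qed
    also have "\<dots> \<le> 0"
    proof (intro sum_nonpos)
      fix s t assume st: "s \<in> P" "t \<in> N"
      then have "inner s t \<le> 0" "u s * (- u t) \<ge> 0"
        using obt fP(4-6) by (auto simp: P_def N_def mult_nonneg_nonpos)
      then show "u s * (- u t) * inner s t \<le> 0" using mult_nonneg_nonpos by blast
    qed
    finally have z0: "z = 0" using inner_ge_zero[of z] by (metis antisym inner_eq_zero_iff)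
    have "(\<Sum>s\<in>P. u s * inner v s) = inner v z"
      unfolding z_def by (simp add: inner_sum_right)
    then have "(\<Sum>s\<in>P. u s * inner v s) = 0" using z0 by simp
    moreover have "u s * inner v s \<ge> 0" if "s \<in> P" for s
      using that pos[of s] by (auto simp: P_def intro!: mult_nonneg_nonneg)
    ultimately have 1: "\<forall>s\<in>P. u s * inner v s = 0"
      using sum_nonneg_eq_0_iff[OF fP(1), of "\<lambda>s. u s * inner v s"] by blast
    have "(\<Sum>s\<in>N. (- u s) * inner v s) = inner v z"
      by (subst z2) (simp add: inner_sum_right)
    then have "(\<Sum>s\<in>N. (- u s) * inner v s) = 0" using z0 by simp
    moreover have "(- u s) * inner v s \<ge> 0" if "s \<in> N" for s
      using that pos[of s] by (intro mult_nonneg_nonneg) (auto simp: N_def)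
    ultimately have 2: "\<forall>s\<in>N. (- u s) * inner v s = 0"
      using sum_nonneg_eq_0_iff[OF fP(2), of "\<lambda>s. (- u s) * inner v s"] by blast
    have "u s * inner v s = 0" using 1 2 s fP(3) by fastforce
    then show ?thesis using pos[OF s] by simp
  qed
  then show ?thesis by (rule independent_if_scalars_zero[OF fin])
qed

text \<open>Real nonnegative relations among vectors of a lattice can be rounded to integral ones:
  by simultaneous Dirichlet approximation a multiple of the coefficients is so close to integers
  that the integral pairings with the rounded relation have absolute value below 1.\<close>

lemma integral_dependence:
  fixes G D :: "'b::euclidean_space set" and c :: "'b \<Rightarrow> real"
  assumes finG: "finite G" and finD: "finite D"
    and int: "\<And>d g. d \<in> D \<Longrightarrow> g \<in> G \<Longrightarrow> inner d g \<in> \<int>"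
    and sep: "\<And>x. (\<And>d. d \<in> D \<Longrightarrow> inner d x = 0) \<Longrightarrow> x = 0"
    and c0: "\<And>g. g \<in> G \<Longrightarrow> c g \<ge> 0" and c1: "sum c G = 1"
    and dep: "(\<Sum>g\<in>G. c g *\<^sub>R g) = 0"
  shows "\<exists>n::'b \<Rightarrow> nat. (\<exists>g\<in>G. n g > 0) \<and> (\<Sum>g\<in>G. real (n g) *\<^sub>R g) = 0"
proof -
  define K where "K = card G"
  obtain e where e: "bij_betw e {..<K} G"
    using finG ex_bij_betw_nat_finite unfolding K_def atLeast0LessThan by blast
  \<comment> \<open>\<open>N\<close> exceeds the sum of all absolute pairings, so coefficient errors
    below \<open>1 / N\<close> change each pairing by less than 1.\<close>
  obtain N :: nat where N: "real N > 1 + (\<Sum>d\<in>D. \<Sum>g\<in>G. \<bar>inner d g\<bar>)"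
    using reals_Archimedean2 by blast
  have S0: "(\<Sum>d\<in>D. \<Sum>g\<in>G. \<bar>inner d g\<bar>) \<ge> 0" by (intro sum_nonneg) auto
  have N1: "real N > 1" "N > 0" using N S0 by auto
  obtain q' p where q': "q' > 0" "q' \<le> int (N ^ K)"
    and p': "\<And>i. i < K \<Longrightarrow> \<bar>of_int q' * (real K * c (e i)) - of_int (p i)\<bar> < 1 / real N"
    by (rule Dirichlet_approx_simult[OF \<open>N > 0\<close>, where \<theta> = "\<lambda>i. real K * c (e i)" and n = K]) (rule that)
  define q where "q = nat q'"
  have q: "q > 0" and qq: "of_int q' = real q" using q'(1) unfolding q_def by simp_all
  note p = p'[unfolded qq]
  define r where "r g = p (the_inv_into {..<K} e g)" for g
  have r: "\<bar>real q * (real K * c g) - of_int (r g)\<bar> < 1 / real N" if gG: "g \<in> G" for g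
  proof -
    obtain i where "i < K" "g = e i" using gG bij_betw_imp_surj_on[OF e] by blast
    then show ?thesis using p[of i] e by (simp add: r_def bij_betw_def the_inv_into_f_f)
  qed
  have N2: "1 / real N < 1" using N1 by simp
  have r0: "r g \<ge> 0" if "g \<in> G" for g
  proof -
    have "real q * (real K * c g) \<ge> 0" using c0[OF that] by simp
    then have "of_int (r g) > (-1::real)" using r[OF that] N2 by linarith
    then show ?thesis by linarith
  qed
  define n where "n g = nat (r g)" for g
  have n: "\<bar>real q * (real K * c g) - real (n g)\<bar> < 1 / real N" if "g \<in> G" for g
    using r[OF that] r0[OF that] by (simp add: n_def)
  \<comment> \<open>The weights sum to 1 over \<open>K\<close> vectors, so one of them is at least
    \<open>1 / K\<close>. The factor \<open>K\<close> in the approximated numbers thus keeps the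
    rounded relation from being zero.\<close>
  have "\<exists>g\<in>G. real K * c g \<ge> 1"
  proof (rule ccontr)
    assume *: "\<not> ?thesis"
    have "G \<noteq> {}" using c1 by auto
    then have "(\<Sum>g\<in>G. real K * c g) < (\<Sum>g\<in>G. 1)"
      using * finG by (intro sum_strict_mono) auto
    then show False using c1 by (simp add: sum_distrib_left[symmetric] K_def)
  qed
  then obtain g where g: "g \<in> G" "real K * c g \<ge> 1" by blast
  have "real q * (real K * c g) \<ge> 1 * 1" using g(2) q by (intro mult_mono) auto
  then have "real (n g) > 0" using n[OF g(1)] N2 by linarith
  then have pos: "\<exists>g\<in>G. n g > 0" using g by auto
  have "inner d (\<Sum>g\<in>G. real (n g) *\<^sub>R g) = 0" if d: "d \<in> D" for d
  proof -
    let ?y = "inner d (\<Sum>g\<in>G. real (n g) *\<^sub>R g)"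
    have y: "?y = (\<Sum>g\<in>G. real (n g) * inner d g)" by (simp add: inner_sum_right)
    then have yI: "?y \<in> \<int>" using int[OF d] by (auto intro!: Ints_sum Ints_mult)
    have "inner d (\<Sum>g\<in>G. c g *\<^sub>R g) = 0" by (simp add: dep)
    then have "(\<Sum>g\<in>G. real q * (real K * c g) * inner d g) = 0"
      by (simp add: inner_sum_right mult.assoc sum_distrib_left[symmetric])
    then have "\<bar>?y\<bar> = \<bar>\<Sum>g\<in>G. (real (n g) - real q * (real K * c g)) * inner d g\<bar>"
      by (simp add: y left_diff_distrib sum_subtractf)
    also have "\<dots> \<le> (\<Sum>g\<in>G. \<bar>(real (n g) - real q * (real K * c g)) * inner d g\<bar>)"
      by (rule sum_abs)
    also have "\<dots> \<le> (\<Sum>g\<in>G. (1 / real N) * \<bar>inner d g\<bar>)"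
      unfolding abs_mult using n by (intro sum_mono mult_right_mono) (auto simp: abs_minus_commute less_imp_le)
    also have "\<dots> = (\<Sum>g\<in>G. \<bar>inner d g\<bar>) / real N" by (simp add: sum_divide_distrib)
    finally have le: "\<bar>?y\<bar> \<le> (\<Sum>g\<in>G. \<bar>inner d g\<bar>) / real N" .
    have "(\<Sum>g\<in>G. \<bar>inner d g\<bar>) \<le> (\<Sum>d\<in>D. \<Sum>g\<in>G. \<bar>inner d g\<bar>)"
      using member_le_sum[OF d, of "\<lambda>d. \<Sum>g\<in>G. \<bar>inner d g\<bar>"] finD by (simp add: sum_nonneg)
    also have "\<dots> < real N" using N by simp
    finally have "(\<Sum>g\<in>G. \<bar>inner d g\<bar>) / real N < 1" using N1 by simp
    then have "\<bar>?y\<bar> < 1" using le by linarith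
    then show ?thesis using yI by (metis Ints_nonzero_abs_less1)
  qed
  then have "(\<Sum>g\<in>G. real (n g) *\<^sub>R g) = 0" using sep by blast
  then show ?thesis using pos by blast
qed

text \<open>Either 0 is a convex combination of \<open>G\<close>, or a hyperplane strictly separates
  it from the compact hull of \<open>G\<close>.\<close>

lemma gordan:
  fixes G :: "'b::euclidean_space set"
  assumes "finite G" "G \<noteq> {}"
  shows "(\<exists>w. \<forall>g\<in>G. inner w g > 0) \<or>
    (\<exists>c. (\<forall>g\<in>G. c g \<ge> 0) \<and> sum c G = (1::real) \<and> (\<Sum>g\<in>G. c g *\<^sub>R g) = 0)"
proof (cases "0 \<in> convex hull G")
  case True
  then show ?thesis using assms by (auto simp: convex_hull_finite)
next
  case False
  have "closed (convex hull G)" using assms by (simp add: compact_convex_hull compact_imp_closed finite_imp_compact)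
  then obtain a b where "0 < b" "\<forall>x\<in>convex hull G. inner a x > b"
    using separating_hyperplane_closed_0[OF convex_convex_hull _ False] by blast
  then have "\<forall>g\<in>G. inner a g > 0" using hull_subset[of G convex] by force
  then show ?thesis by blast
qed

lemma sum_mset_sum_replicate:
  fixes n :: "'i \<Rightarrow> nat" and f :: "'b \<Rightarrow> 'c::real_vector"
  assumes "finite G"
  shows "sum_mset (image_mset f (\<Sum>g\<in>G. replicate_mset (n g) (h g))) = (\<Sum>g\<in>G. real (n g) *\<^sub>R f (h g))"
proof -
  have rep: "sum_mset (replicate_mset k x) = real k *\<^sub>R x" for k and x :: 'c
    by (induction k) (simp_all add: scaleR_add_left)
  show ?thesis using assms by (induction G rule: finite_induct) (auto simp: rep)
qed

text \<open>The part \<open>y\<close> of \<open>\<alpha>\<close> orthogonal to \<open>a\<close> is a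
  direction inside the hyperplane. Since \<open>\<alpha>\<close> is constant there, \<open>y\<close>
  is orthogonal to \<open>\<alpha>\<close>, hence to itself.\<close>

lemma hyperplane_subset_parallel:
  fixes a \<alpha> :: "'a::euclidean_space"
  assumes a: "a \<noteq> 0" and sub: "{x. inner a x = b} \<subseteq> {x. inner \<alpha> x = c}"
  shows "\<exists>l. \<alpha> = l *\<^sub>R a \<and> c = l * b"
proof -
  define l where "l = inner \<alpha> a / inner a a"
  define y where "y = \<alpha> - l *\<^sub>R a"
  define x0 where "x0 = (b / inner a a) *\<^sub>R a"
  have aa: "inner a a \<noteq> 0" using a by simp
  have ay: "inner a y = 0" using aa by (simp add: y_def l_def inner_diff_right inner_commute)
  have x0: "inner a x0 = b" using aa by (simp add: x0_def)
  then have 1: "inner \<alpha> x0 = c" using sub by auto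
  have "inner a (x0 + y) = b" using x0 ay by (simp add: inner_add_right)
  then have "inner \<alpha> (x0 + y) = c" using sub by blast
  then have "inner \<alpha> y = 0" using 1 by (simp add: inner_add_right)
  then have "inner y y = 0" using ay by (simp add: y_def inner_diff_left)
  then have "\<alpha> = l *\<^sub>R a" by (simp add: y_def)
  moreover have "c = l * b" using 1 x0 calculation by simp
  ultimately show ?thesis by blast
qed

text \<open>\<open>separates\<close> allows any equation of the hyperplane. Two equations differ by
  a nonzero factor, and a negative factor only swaps the two alternatives.\<close>

lemma separates_hyp_iff:
  fixes \<alpha> :: "'a::euclidean_space"
  assumes "\<alpha> \<noteq> 0"
  shows "separates (hyp \<alpha> c) A B \<longleftrightarrow>
     A \<subseteq> {x. inner \<alpha> x < c} \<and> B \<subseteq> {x. inner \<alpha> x > c} \<or>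
     A \<subseteq> {x. inner \<alpha> x > c} \<and> B \<subseteq> {x. inner \<alpha> x < c}" (is "?l \<longleftrightarrow> ?r")
proof
  assume ?l
  then obtain a b where ab: "a \<noteq> 0" "hyp \<alpha> c = {x. inner a x = b}"
    and s: "(A \<subseteq> {x. inner a x < b} \<and> B \<subseteq> {x. inner a x > b}) \<or>
         (A \<subseteq> {x. inner a x > b} \<and> B \<subseteq> {x. inner a x < b})"
    by (auto simp: separates_def)
  obtain l where l: "a = l *\<^sub>R \<alpha>" "b = l * c"
    using hyperplane_subset_parallel[OF assms, of c a b] ab(2) by (auto simp: hyp_def)
  have "l > 0 \<or> l < 0" using ab(1) l(1) by (metis linorder_neqE_linordered_idom scale_zero_left)
  then show ?r using s unfolding l by (auto simp: subset_iff)
next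
  assume ?r
  then show ?l using assms unfolding separates_def hyp_def by (intro exI[of _ \<alpha>] exI[of _ c]) auto
qed

section \<open>Positive roots\<close>

text \<open>\<open>v\<close> is a witness for \<open>positive_system\<close>. Being strictly
  positive on \<open>\<Phi>p\<close>, it serves as a height: it orders inductions, excludes zero
  sums and decides which of \<open>\<alpha>\<close> and \<open>- \<alpha>\<close> is
  positive.\<close>

locale positive_roots =
  fixes \<Phi> \<Phi>p :: "'a::euclidean_space set" and v :: 'a
  assumes root_system: "crystallographic_root_system \<Phi>"
    and generic: "\<And>\<alpha>. \<alpha> \<in> \<Phi> \<Longrightarrow> inner v \<alpha> \<noteq> 0"
    and pos_def: "\<Phi>p = {\<alpha>\<in>\<Phi>. inner v \<alpha> > 0}"
begin

abbreviation "\<Delta> \<equiv> simple_roots \<Phi>p"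

lemma finite_roots: "finite \<Phi>" "finite \<Phi>p"
  using root_system unfolding crystallographic_root_system_def pos_def by simp_all

lemma zero_not_root: "0 \<notin> \<Phi>" and span_roots: "span \<Phi> = UNIV"
  using root_system unfolding crystallographic_root_system_def by simp_all

lemma refl_root: "\<alpha> \<in> \<Phi> \<Longrightarrow> \<beta> \<in> \<Phi> \<Longrightarrow> reflection \<alpha> \<beta> \<in> \<Phi>"
  and cartan_int: "\<alpha> \<in> \<Phi> \<Longrightarrow> \<beta> \<in> \<Phi> \<Longrightarrow> (2 * inner \<beta> \<alpha>) / inner \<alpha> \<alpha> \<in> \<int>"
  and scale_root: "\<alpha> \<in> \<Phi> \<Longrightarrow> c *\<^sub>R \<alpha> \<in> \<Phi> \<Longrightarrow> c = 1 \<or> c = -1"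
  using root_system unfolding crystallographic_root_system_def by blast+

lemma pos_subset: "\<Phi>p \<subseteq> \<Phi>" and pos_gt: "\<alpha> \<in> \<Phi>p \<Longrightarrow> inner v \<alpha> > 0"
  by (auto simp: pos_def)

lemma pos_nonzero: "\<alpha> \<in> \<Phi>p \<Longrightarrow> \<alpha> \<noteq> 0"
  using pos_gt by force

lemma simple_subset: "\<Delta> \<subseteq> \<Phi>p" and finite_simple: "finite \<Delta>"
  using finite_roots by (auto simp: simple_roots_def)

lemma uminus_root: "\<alpha> \<in> \<Phi> \<Longrightarrow> - \<alpha> \<in> \<Phi>"
proof -
  assume a: "\<alpha> \<in> \<Phi>"
  then have "\<alpha> \<noteq> 0" using zero_not_root by auto
  then have "reflection \<alpha> \<alpha> = - \<alpha>" by (simp add: reflection_def scaleR_2)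
  then show ?thesis using refl_root[OF a a] by simp
qed

lemma root_pos_or_neg: "\<alpha> \<in> \<Phi> \<Longrightarrow> \<alpha> \<in> \<Phi>p \<or> - \<alpha> \<in> \<Phi>p"
  using generic[of \<alpha>] uminus_root by (fastforce simp: pos_def)

lemma pos_parallel:
  assumes "\<alpha> \<in> \<Phi>p" "\<beta> \<in> \<Phi>p" "\<beta> = c *\<^sub>R \<alpha>"
  shows "\<beta> = \<alpha>"
proof -
  have "c = 1 \<or> c = -1" using assms scale_root pos_subset by blast
  moreover have "c \<noteq> -1" using pos_gt[OF assms(1)] pos_gt[OF assms(2)] assms(3) by auto
  ultimately show ?thesis using assms(3) by simp
qed

text \<open>Both Cartan integers are positive. If both were at least 2,
  \<open>\<alpha> - \<beta>\<close> would have norm 0; so one of them is 1, and the corresponding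
  reflection yields the difference up to sign.\<close>

lemma diff_root:
  assumes a: "\<alpha> \<in> \<Phi>" and b: "\<beta> \<in> \<Phi>" and pos: "inner \<alpha> \<beta> > 0" and ne: "\<alpha> \<noteq> \<beta>"
  shows "\<alpha> - \<beta> \<in> \<Phi>"
proof -
  have nz: "\<alpha> \<noteq> 0" "\<beta> \<noteq> 0" using a b zero_not_root by auto
  then have aa: "inner \<alpha> \<alpha> > 0" "inner \<beta> \<beta> > 0" by auto
  obtain p :: int where p: "2 * inner \<alpha> \<beta> / inner \<beta> \<beta> = of_int p" using cartan_int[OF b a] by (auto elim: Ints_cases)
  obtain q :: int where q: "2 * inner \<beta> \<alpha> / inner \<alpha> \<alpha> = of_int q" using cartan_int[OF a b] by (auto elim: Ints_cases)
  have "of_int p > (0::real)" "of_int q > (0::real)"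
    using aa pos by (simp_all add: p[symmetric] q[symmetric] inner_commute)
  then have pq0: "p \<ge> 1" "q \<ge> 1" by auto
  have "\<not> (p \<ge> 2 \<and> q \<ge> 2)"
  proof
    assume pq: "p \<ge> 2 \<and> q \<ge> 2"
    then have "of_int p \<ge> (2::real)" "of_int q \<ge> (2::real)" by auto
    then have 1: "inner \<alpha> \<beta> \<ge> inner \<beta> \<beta>" "inner \<alpha> \<beta> \<ge> inner \<alpha> \<alpha>"
      using aa unfolding p[symmetric] q[symmetric] by (simp_all add: field_simps inner_commute)
    have "inner (\<alpha> - \<beta>) (\<alpha> - \<beta>) = inner \<alpha> \<alpha> + inner \<beta> \<beta> - 2 * inner \<alpha> \<beta>"
      by (simp add: inner_diff_left inner_diff_right inner_commute)
    also have "\<dots> \<le> 0" using 1 by linarith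
    finally have "\<alpha> - \<beta> = 0" by (metis inner_ge_zero antisym inner_eq_zero_iff)
    then show False using ne by simp
  qed
  then consider "p = 1" | "q = 1" using pq0 by linarith
  then show ?thesis
  proof cases
    case 1
    then have "reflection \<beta> \<alpha> = \<alpha> - \<beta>" unfolding reflection_def p by simp
    then show ?thesis using refl_root[OF b a] by simp
  next
    case 2
    then have "reflection \<alpha> \<beta> = \<beta> - \<alpha>" unfolding reflection_def q by simp
    then show ?thesis using uminus_root[OF refl_root[OF a b]] by simp
  qed
qed

lemma sum_root:
  assumes "\<alpha> \<in> \<Phi>" "\<beta> \<in> \<Phi>" "inner \<alpha> \<beta> < 0" "\<alpha> + \<beta> \<noteq> 0"
  shows "\<alpha> + \<beta> \<in> \<Phi>"
  using diff_root[of \<alpha> "- \<beta>"] assms uminus_root by (auto simp: eq_neg_iff_add_eq_0)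

lemma sum_pos_root:
  assumes "\<alpha> \<in> \<Phi>p" "\<beta> \<in> \<Phi>p" "inner \<alpha> \<beta> < 0"
  shows "\<alpha> + \<beta> \<in> \<Phi>p"
proof -
  have "inner v (\<alpha> + \<beta>) > 0" using pos_gt assms by (simp add: inner_add_right add_pos_pos)
  moreover from this have "\<alpha> + \<beta> \<noteq> 0" by force
  ultimately show ?thesis using sum_root assms pos_subset by (auto simp: pos_def)
qed

lemma diff_pos_root:
  assumes "\<alpha> \<in> \<Phi>p" "\<beta> \<in> \<Phi>p" "inner \<alpha> \<beta> > 0" "\<alpha> \<noteq> \<beta>"
  shows "\<alpha> - \<beta> \<in> \<Phi>p \<or> \<beta> - \<alpha> \<in> \<Phi>p"
  using diff_root[of \<alpha> \<beta>] root_pos_or_neg[of "\<alpha> - \<beta>"] assms pos_subset by auto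

section \<open>Simple roots as a basis with natural number coordinates\<close>

lemma simple_obtuse:
  assumes "\<sigma> \<in> \<Delta>" "\<tau> \<in> \<Delta>" "\<sigma> \<noteq> \<tau>"
  shows "inner \<sigma> \<tau> \<le> 0"
proof (rule ccontr)
  assume "\<not> ?thesis"
  moreover have st: "\<sigma> \<in> \<Phi>p" "\<tau> \<in> \<Phi>p" using assms simple_subset by auto
  ultimately have "\<sigma> - \<tau> \<in> \<Phi>p \<or> \<tau> - \<sigma> \<in> \<Phi>p" using diff_pos_root assms by auto
  moreover have "\<sigma> = \<tau> + (\<sigma> - \<tau>)" "\<tau> = \<sigma> + (\<tau> - \<sigma>)" by auto
  ultimately show False using assms st by (fastforce simp: simple_roots_def)
qed

lemma independent_simple: "independent \<Delta>"
  using independent_obtuse[OF finite_simple, of v] simple_obtuse simple_subset pos_gt by blast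

text \<open>Heights are real numbers, so well-foundedness comes from finiteness: the number of
  positive roots of smaller height decreases.\<close>

lemma pos_induct [consumes 1, case_names step]:
  assumes "\<alpha> \<in> \<Phi>p"
    and step: "\<And>\<alpha>. \<alpha> \<in> \<Phi>p \<Longrightarrow> (\<And>\<beta>. \<beta> \<in> \<Phi>p \<Longrightarrow> inner v \<beta> < inner v \<alpha> \<Longrightarrow> P \<beta>) \<Longrightarrow> P \<alpha>"
  shows "P \<alpha>"
  using assms(1)
proof (induction "card {\<beta>\<in>\<Phi>p. inner v \<beta> < inner v \<alpha>}" arbitrary: \<alpha> rule: less_induct)
  case less
  show ?case
  proof (rule step[OF less.prems])
    fix \<beta> assume b: "\<beta> \<in> \<Phi>p" "inner v \<beta> < inner v \<alpha>"
    then have "{\<gamma>\<in>\<Phi>p. inner v \<gamma> < inner v \<beta>} \<subset> {\<gamma>\<in>\<Phi>p. inner v \<gamma> < inner v \<alpha>}" by fastforce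
    then have "card {\<gamma>\<in>\<Phi>p. inner v \<gamma> < inner v \<beta>} < card {\<gamma>\<in>\<Phi>p. inner v \<gamma> < inner v \<alpha>}"
      using finite_roots by (intro psubset_card_mono) auto
    then show "P \<beta>" using less.hyps b by blast
  qed
qed

lemma pos_root_nat_coords:
  assumes "\<alpha> \<in> \<Phi>p"
  shows "\<exists>n::'a \<Rightarrow> nat. \<alpha> = (\<Sum>\<sigma>\<in>\<Delta>. real (n \<sigma>) *\<^sub>R \<sigma>)"
  using assms
proof (induction rule: pos_induct)
  case (step \<alpha>)
  show ?case
  proof (cases "\<alpha> \<in> \<Delta>")
    case True
    have "\<alpha> = (\<Sum>\<sigma>\<in>\<Delta>. real (if \<sigma> = \<alpha> then 1 else 0) *\<^sub>R \<sigma>)"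
    proof -
      have "(\<Sum>\<sigma>\<in>\<Delta>. real (if \<sigma> = \<alpha> then 1 else 0) *\<^sub>R \<sigma>) = (\<Sum>\<sigma>\<in>\<Delta>. if \<sigma> = \<alpha> then \<alpha> else 0)"
        by (rule sum.cong) auto
      then show ?thesis using True finite_simple by simp
    qed
    then show ?thesis by (rule exI[of _ "\<lambda>\<sigma>. if \<sigma> = \<alpha> then 1 else 0"])
  next
    case False
    then obtain \<beta> \<gamma> where bc: "\<beta> \<in> \<Phi>p" "\<gamma> \<in> \<Phi>p" "\<alpha> = \<beta> + \<gamma>" using step.hyps by (auto simp: simple_roots_def)
    then have "inner v \<beta> < inner v \<alpha>" "inner v \<gamma> < inner v \<alpha>" using pos_gt by (auto simp: inner_add_right)
    then obtain n n' :: "'a \<Rightarrow> nat" where "\<beta> = (\<Sum>\<sigma>\<in>\<Delta>. real (n \<sigma>) *\<^sub>R \<sigma>)" "\<gamma> = (\<Sum>\<sigma>\<in>\<Delta>. real (n' \<sigma>) *\<^sub>R \<sigma>)"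
      using step.IH bc by meson
    then have "\<alpha> = (\<Sum>\<sigma>\<in>\<Delta>. real (n \<sigma> + n' \<sigma>) *\<^sub>R \<sigma>)"
      using bc(3) by (simp add: scaleR_add_left sum.distrib)
    then show ?thesis by (rule exI[of _ "\<lambda>\<sigma>. n \<sigma> + n' \<sigma>"])
  qed
qed

lemma span_simple: "span \<Delta> = UNIV"
proof -
  have "\<alpha> \<in> span \<Delta>" if "\<alpha> \<in> \<Phi>p" for \<alpha>
  proof -
    obtain n :: "'a \<Rightarrow> nat" where "\<alpha> = (\<Sum>\<sigma>\<in>\<Delta>. real (n \<sigma>) *\<^sub>R \<sigma>)"
      using pos_root_nat_coords[OF \<open>\<alpha> \<in> \<Phi>p\<close>] by blast
    moreover have "(\<Sum>\<sigma>\<in>\<Delta>. real (n \<sigma>) *\<^sub>R \<sigma>) \<in> span \<Delta>" by (intro span_sum span_scale span_base)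
    ultimately show ?thesis by argo
  qed
  then have "\<Phi> \<subseteq> span \<Delta>" using root_pos_or_neg span_neg by (metis minus_minus subsetI)
  then have "span \<Phi> \<subseteq> span \<Delta>" by (simp add: span_minimal)
  then show ?thesis using span_roots by auto
qed

lemma simple_coords_unique:
  assumes "(\<Sum>\<sigma>\<in>\<Delta>. a \<sigma> *\<^sub>R \<sigma>) = (\<Sum>\<sigma>\<in>\<Delta>. b \<sigma> *\<^sub>R \<sigma>)" "\<sigma> \<in> \<Delta>"
  shows "a \<sigma> = b \<sigma>"
proof -
  have "(\<Sum>\<sigma>\<in>\<Delta>. (a \<sigma> - b \<sigma>) *\<^sub>R \<sigma>) = 0" using assms(1) by (simp add: scaleR_diff_left sum_subtractf)
  then have "a \<sigma> - b \<sigma> = 0"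
    using independentD[OF independent_simple finite_simple order_refl, of "\<lambda>\<sigma>. a \<sigma> - b \<sigma>"] assms(2) by blast
  then show ?thesis by simp
qed

lemma nonneg_comb_simple:
  assumes c: "\<And>\<gamma>. \<gamma> \<in> \<Phi>p \<Longrightarrow> c \<gamma> \<ge> (0::real)"
  shows "\<exists>d. (\<forall>\<sigma>\<in>\<Delta>. d \<sigma> \<ge> 0) \<and> (\<Sum>\<gamma>\<in>\<Phi>p. c \<gamma> *\<^sub>R \<gamma>) = (\<Sum>\<sigma>\<in>\<Delta>. d \<sigma> *\<^sub>R \<sigma>)"
proof -
  obtain n :: "'a \<Rightarrow> 'a \<Rightarrow> nat" where n: "\<And>\<gamma>. \<gamma> \<in> \<Phi>p \<Longrightarrow> \<gamma> = (\<Sum>\<sigma>\<in>\<Delta>. real (n \<gamma> \<sigma>) *\<^sub>R \<sigma>)"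
    using pos_root_nat_coords by metis
  have "(\<Sum>\<gamma>\<in>\<Phi>p. c \<gamma> *\<^sub>R \<gamma>) = (\<Sum>\<gamma>\<in>\<Phi>p. c \<gamma> *\<^sub>R (\<Sum>\<sigma>\<in>\<Delta>. real (n \<gamma> \<sigma>) *\<^sub>R \<sigma>))"
    using n by (intro sum.cong refl) metis
  also have "\<dots> = (\<Sum>\<gamma>\<in>\<Phi>p. \<Sum>\<sigma>\<in>\<Delta>. (c \<gamma> * real (n \<gamma> \<sigma>)) *\<^sub>R \<sigma>)" by (simp add: scaleR_sum_right)
  also have "\<dots> = (\<Sum>\<sigma>\<in>\<Delta>. (\<Sum>\<gamma>\<in>\<Phi>p. c \<gamma> * real (n \<gamma> \<sigma>)) *\<^sub>R \<sigma>)"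
    by (subst sum.swap) (simp add: scaleR_sum_left)
  finally show ?thesis using c by (intro exI[of _ "\<lambda>\<sigma>. \<Sum>\<gamma>\<in>\<Phi>p. c \<gamma> * real (n \<gamma> \<sigma>)"]) (auto intro!: sum_nonneg)
qed

text \<open>\<open>root_le\<close> permits real coefficients, but simple roots are independent and
  both roots have natural coordinates, so the difference has natural coordinates too. Their sum is
  what the next induction runs on.\<close>

lemma root_le_nat_coords:
  assumes ab: "\<alpha> \<in> \<Phi>p" "\<beta> \<in> \<Phi>p" and le: "root_le \<Phi>p \<alpha> \<beta>"
  shows "\<exists>n::'a \<Rightarrow> nat. \<beta> = \<alpha> + (\<Sum>\<sigma>\<in>\<Delta>. real (n \<sigma>) *\<^sub>R \<sigma>)"
proof -
  obtain a b :: "'a \<Rightarrow> nat" where a: "\<alpha> = (\<Sum>\<sigma>\<in>\<Delta>. real (a \<sigma>) *\<^sub>R \<sigma>)" and b: "\<beta> = (\<Sum>\<sigma>\<in>\<Delta>. real (b \<sigma>) *\<^sub>R \<sigma>)"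
    using pos_root_nat_coords ab by meson
  obtain d where d: "\<forall>\<sigma>\<in>\<Delta>. d \<sigma> \<ge> (0::real)" "\<beta> - \<alpha> = (\<Sum>\<sigma>\<in>\<Delta>. d \<sigma> *\<^sub>R \<sigma>)"
    using le nonneg_comb_simple unfolding root_le_def by metis
  have "(\<Sum>\<sigma>\<in>\<Delta>. real (b \<sigma>) *\<^sub>R \<sigma>) = \<alpha> + (\<Sum>\<sigma>\<in>\<Delta>. d \<sigma> *\<^sub>R \<sigma>)"
    using d(2) b by (metis add.commute diff_add_cancel)
  also have "\<dots> = (\<Sum>\<sigma>\<in>\<Delta>. (real (a \<sigma>) + d \<sigma>) *\<^sub>R \<sigma>)"
    by (subst a) (simp add: scaleR_add_left sum.distrib)
  finally have "real (b \<sigma>) = real (a \<sigma>) + d \<sigma>" if "\<sigma> \<in> \<Delta>" for \<sigma>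
    by (rule simple_coords_unique[where a = "\<lambda>\<sigma>. real (b \<sigma>)" and b = "\<lambda>\<sigma>. real (a \<sigma>) + d \<sigma>"]) (rule that)
  then have "d \<sigma> = real (b \<sigma> - a \<sigma>)" if "\<sigma> \<in> \<Delta>" for \<sigma>
    using d(1) that by (smt (verit, best) of_nat_diff of_nat_le_iff)
  then have "\<beta> = \<alpha> + (\<Sum>\<sigma>\<in>\<Delta>. real (b \<sigma> - a \<sigma>) *\<^sub>R \<sigma>)" using d(2) by (simp add: algebra_simps)
  then show ?thesis by (rule exI[of _ "\<lambda>\<sigma>. b \<sigma> - a \<sigma>"])
qed

text \<open>The root poset is graded: whenever \<open>\<alpha> < \<beta>\<close>, a simple root can be added to \<open>\<alpha>\<close> or subtracted
  from \<open>\<beta>\<close> without leaving the interval, since \<open>\<beta> - \<alpha>\<close> has positive norm.\<close>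

lemma up_closed_add:
  assumes I: "I \<subseteq> \<Phi>p" and up: "\<And>\<alpha> \<gamma>. \<alpha> \<in> I \<Longrightarrow> \<gamma> \<in> \<Phi>p \<Longrightarrow> \<alpha> + \<gamma> \<in> \<Phi>p \<Longrightarrow> \<alpha> + \<gamma> \<in> I"
    and "\<alpha> \<in> I" "\<beta> \<in> \<Phi>p" "\<beta> = \<alpha> + (\<Sum>\<sigma>\<in>\<Delta>. real (n \<sigma>) *\<^sub>R \<sigma>)"
  shows "\<beta> \<in> I"
  using assms(3-5)
proof (induction "\<Sum>\<sigma>\<in>\<Delta>. n \<sigma>" arbitrary: n \<alpha> \<beta> rule: less_induct)
  case less
  let ?s = "\<lambda>n::'a \<Rightarrow> nat. \<Sum>\<sigma>\<in>\<Delta>. real (n \<sigma>) *\<^sub>R \<sigma>"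
  have a: "\<alpha> \<in> \<Phi>p" using less.prems(1) I by auto
  show ?case
  proof (cases "\<beta> = \<alpha>")
    case True
    then show ?thesis using less.prems by simp
  next
    case False
    \<comment> \<open>The squared norm of \<open>\<beta> - \<alpha>\<close> is expanded in one
      argument only; a positive term yields a simple root that occurs in the difference and has
      positive product with it.\<close>
    then have "?s n \<noteq> 0" using less.prems(3) by auto
    then have "inner (?s n) (?s n) > 0" by simp
    then have "(\<Sum>\<sigma>\<in>\<Delta>. real (n \<sigma>) * inner \<sigma> (?s n)) > 0"
      by (metis (no_types, lifting) inner_scaleR_left inner_sum_left sum.cong)
    then obtain \<sigma> where s: "\<sigma> \<in> \<Delta>" "real (n \<sigma>) * inner \<sigma> (?s n) > 0"
      by (meson not_le sum_nonpos)
    then have n1: "n \<sigma> \<ge> 1" and ip: "inner \<sigma> (\<beta> - \<alpha>) > 0"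
      using less.prems(3) by (auto simp: zero_less_mult_iff)
    have sp: "\<sigma> \<in> \<Phi>p" using s simple_subset by auto
    define n' where "n' = n(\<sigma> := n \<sigma> - 1)"
    have sn: "?s n = \<sigma> + ?s n'"
    proof -
      have "?s n = real (n \<sigma>) *\<^sub>R \<sigma> + (\<Sum>\<sigma>\<in>\<Delta>-{\<sigma>}. real (n \<sigma>) *\<^sub>R \<sigma>)"
        using s(1) finite_simple by (rule sum.remove[rotated])
      moreover have "?s n' = real (n \<sigma> - 1) *\<^sub>R \<sigma> + (\<Sum>\<sigma>\<in>\<Delta>-{\<sigma>}. real (n \<sigma>) *\<^sub>R \<sigma>)"
        using s(1) finite_simple by (subst sum.remove[of _ \<sigma>]) (auto simp: n'_def)
      moreover have "real (n \<sigma>) *\<^sub>R \<sigma> = \<sigma> + real (n \<sigma> - 1) *\<^sub>R \<sigma>"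
        using n1 by (simp add: of_nat_diff scaleR_diff_left)
      ultimately show ?thesis by simp
    qed
    have lt: "(\<Sum>\<sigma>\<in>\<Delta>. n' \<sigma>) < (\<Sum>\<sigma>\<in>\<Delta>. n \<sigma>)"
      using s(1) n1 finite_simple by (intro sum_strict_mono_ex1) (auto simp: n'_def)
    have vn: "inner v (?s n') \<ge> 0"
      unfolding inner_sum_right inner_scaleR_right
      by (intro sum_nonneg mult_nonneg_nonneg) (use simple_subset pos_gt in \<open>auto simp: less_imp_le\<close>)
    have "inner \<sigma> \<beta> > 0 \<or> inner \<sigma> \<alpha> < 0" using ip by (auto simp: inner_diff_right)
    then show ?thesis
    proof
      assume "inner \<sigma> \<alpha> < 0"
      then have as: "\<alpha> + \<sigma> \<in> \<Phi>p" using sum_pos_root a sp by (simp add: inner_commute)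
      then have "\<alpha> + \<sigma> \<in> I" using up less.prems(1) sp by blast
      moreover have "\<beta> = (\<alpha> + \<sigma>) + ?s n'" using less.prems(3) sn by simp
      ultimately show ?thesis using less.hyps lt less.prems(2) by blast
    next
      assume p: "inner \<sigma> \<beta> > 0"
      \<comment> \<open>The height of \<open>\<beta> - \<sigma>\<close> is at least that of
        \<open>\<alpha>\<close>, so this difference root is a positive one.\<close>
      have bs: "\<beta> - \<sigma> = \<alpha> + ?s n'" using less.prems(3) sn by simp
      then have vp: "inner v (\<beta> - \<sigma>) > 0" using vn pos_gt[OF a] by (simp add: inner_add_right)
      then have "\<beta> \<noteq> \<sigma>" by auto
      then have "\<beta> - \<sigma> \<in> \<Phi>" using diff_root p less.prems(2) sp pos_subset by (auto simp: inner_commute)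
      then have b': "\<beta> - \<sigma> \<in> \<Phi>p" using vp by (simp add: pos_def)
      then have "\<beta> - \<sigma> \<in> I" using less.hyps[OF lt less.prems(1) b' bs] by simp
      then have "(\<beta> - \<sigma>) + \<sigma> \<in> I" using up[of "\<beta> - \<sigma>" \<sigma>] sp less.prems(2) by simp
      then show ?thesis by simp
    qed
  qed
qed

text \<open>Reduces the filter condition, which compares arbitrary roots, to adding one positive
  root at a time.\<close>

lemma root_filter_if_up_closed:
  assumes "I \<subseteq> \<Phi>p" "\<And>\<alpha> \<gamma>. \<alpha> \<in> I \<Longrightarrow> \<gamma> \<in> \<Phi>p \<Longrightarrow> \<alpha> + \<gamma> \<in> \<Phi>p \<Longrightarrow> \<alpha> + \<gamma> \<in> I"
  shows "root_filter \<Phi>p I"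
  unfolding root_filter_def
proof (intro conjI ballI impI)
  fix \<alpha> \<beta> assume a: "\<alpha> \<in> I" and b: "\<beta> \<in> \<Phi>p" and le: "root_le \<Phi>p \<alpha> \<beta>"
  obtain n :: "'a \<Rightarrow> nat" where "\<beta> = \<alpha> + (\<Sum>\<sigma>\<in>\<Delta>. real (n \<sigma>) *\<^sub>R \<sigma>)"
    using root_le_nat_coords[OF _ b le] a assms(1) by blast
  from up_closed_add[OF assms a b this] show "\<beta> \<in> I" by simp
qed (rule assms(1))

end

section \<open>Points with prescribed levels\<close>

lemma inner_sum_mset: "inner x (sum_mset M) = sum_mset (image_mset (inner x) M)"
  by (induction M) (auto simp: inner_add_right)

lemma of_nat_sum_image_mset:
  "real (sum_mset (image_mset f M)) = sum_mset (image_mset (\<lambda>x. real (f x)) M)"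
  by (induction M) auto

lemma sum_mset_pos_imp_elem_pos:
  fixes f :: "'b \<Rightarrow> real"
  assumes "sum_mset (image_mset f M) > 0"
  shows "\<exists>x\<in>#M. f x > 0"
  using assms
proof (induction M)
  case (add x M)
  then show ?case by (cases "f x > 0") auto
qed simp

definition cell :: "'a::euclidean_space set \<Rightarrow> nat \<Rightarrow> (nat \<Rightarrow> 'a set) \<Rightarrow> 'a set" where
  "cell \<Phi>p m I = {x. \<forall>\<alpha>\<in>\<Phi>p. \<forall>i\<le>m.
     (\<alpha> \<in> I i \<longrightarrow> inner \<alpha> x > real i) \<and> (\<alpha> \<notin> I i \<longrightarrow> inner \<alpha> x < real i)}"

lemma geometric_chainD:
  assumes "geometric_chain \<Phi>p m I"
  shows "I 0 = \<Phi>p" and "I i \<subseteq> \<Phi>p" and "i \<le> j \<Longrightarrow> I j \<subseteq> I i" and "i > m \<Longrightarrow> I i = I m"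
    and "\<alpha> \<in> I i \<Longrightarrow> \<beta> \<in> I j \<Longrightarrow> \<alpha> + \<beta> \<in> \<Phi>p \<Longrightarrow> \<alpha> + \<beta> \<in> I (i + j)"
    and "i + j \<le> m \<Longrightarrow> \<alpha> \<in> \<Phi>p - I i \<Longrightarrow> \<beta> \<in> \<Phi>p - I j \<Longrightarrow> \<alpha> + \<beta> \<notin> I (i + j)"
proof -
  note g = assms[unfolded geometric_chain_def]
  show i0: "I 0 = \<Phi>p" using g by blast
  have gt: "I i = I m" if "i > m" for i using g that by blast
  then show "i > m \<Longrightarrow> I i = I m" .
  have Suc: "I (Suc i) \<subseteq> I i" for i
  proof (cases "i < m")
    case True then show ?thesis using g by blast
  next
    case False
    then have "I (Suc i) = I m" "I i = I m" using gt by (auto simp: not_less le_less)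
    then show ?thesis by simp
  qed
  then show anti: "i \<le> j \<Longrightarrow> I j \<subseteq> I i" for i j by (simp add: lift_Suc_antimono_le)
  then show sub: "I i \<subseteq> \<Phi>p" for i using i0 by (metis le0)
  have add: "setsum (I i) (I j) \<inter> \<Phi>p \<subseteq> I (i + j)" using g by blast
  show "\<alpha> \<in> I i \<Longrightarrow> \<beta> \<in> I j \<Longrightarrow> \<alpha> + \<beta> \<in> \<Phi>p \<Longrightarrow> \<alpha> + \<beta> \<in> I (i + j)"
    using add unfolding setsum_def by blast
  assume ij: "i + j \<le> m" "\<alpha> \<in> \<Phi>p - I i" "\<beta> \<in> \<Phi>p - I j"
  have "setsum (\<Phi>p - I i) (\<Phi>p - I j) \<inter> \<Phi>p \<subseteq> \<Phi>p - I (i + j)" using g ij(1) by blast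
  then have "\<alpha> + \<beta> \<in> \<Phi>p \<Longrightarrow> \<alpha> + \<beta> \<in> \<Phi>p - I (i + j)" using ij unfolding setsum_def by blast
  then show "\<alpha> + \<beta> \<notin> I (i + j)" using sub by blast
qed

context positive_roots
begin

text \<open>With \<open>j = 0\<close> the sum condition \<open>add\<close> makes every \<open>I i\<close> closed under adding positive roots, hence
  a filter.\<close>

lemma geometric_chainI:
  assumes i0: "I 0 = \<Phi>p" and dec: "\<And>i. i < m \<Longrightarrow> I (Suc i) \<subseteq> I i"
    and const: "\<And>i. i > m \<Longrightarrow> I i = I m"
    and add: "\<And>i j \<alpha> \<beta>. \<alpha> \<in> I i \<Longrightarrow> \<beta> \<in> I j \<Longrightarrow> \<alpha> + \<beta> \<in> \<Phi>p \<Longrightarrow> \<alpha> + \<beta> \<in> I (i + j)"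
    and coadd: "\<And>i j \<alpha> \<beta>. i + j \<le> m \<Longrightarrow> \<alpha> \<in> \<Phi>p - I i \<Longrightarrow> \<beta> \<in> \<Phi>p - I j \<Longrightarrow>
                  \<alpha> + \<beta> \<in> \<Phi>p \<Longrightarrow> \<alpha> + \<beta> \<notin> I (i + j)"
  shows "geometric_chain \<Phi>p m I"
proof -
  have "I i \<subseteq> \<Phi>p" if "i \<le> m" for i
    using that
  proof (induction i)
    case (Suc i)
    then show ?case using dec[of i] by auto
  qed (simp add: i0)
  moreover have "\<alpha> + \<gamma> \<in> I i" if "\<alpha> \<in> I i" "\<gamma> \<in> \<Phi>p" "\<alpha> + \<gamma> \<in> \<Phi>p" for \<alpha> \<gamma> i
    using add[of \<alpha> i \<gamma> 0] that i0 by simp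
  ultimately have "root_filter \<Phi>p (I i)" if "i \<le> m" for i
    using root_filter_if_up_closed[of "I i"] that by blast
  moreover have "setsum (I i) (I j) \<inter> \<Phi>p \<subseteq> I (i + j)" for i j
    using add by (auto simp: setsum_def)
  moreover have "setsum (\<Phi>p - I i) (\<Phi>p - I j) \<inter> \<Phi>p \<subseteq> \<Phi>p - I (i + j)" if "i + j \<le> m" for i j
    using coadd[OF that] by (auto simp: setsum_def)
  ultimately show ?thesis unfolding geometric_chain_def using i0 dec const by blast
qed

text \<open>A relation between two multisets of positive roots with equal sums is shortened by
  choosing a root on each side with positive inner product, and cancelling or subtracting them.\<close>

lemma level_sum_less:
  fixes u :: "'a \<Rightarrow> nat"
  assumes sub: "\<And>\<beta> \<gamma>. \<beta> \<in> \<Phi>p \<Longrightarrow> \<gamma> \<in> \<Phi>p \<Longrightarrow> \<beta> + \<gamma> \<in> \<Phi>p \<Longrightarrow> u (\<beta> + \<gamma>) \<le> u \<beta> + u \<gamma> + 1"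
    and sup: "\<And>\<beta> \<gamma>. \<beta> \<in> \<Phi>p \<Longrightarrow> \<gamma> \<in> \<Phi>p \<Longrightarrow> \<beta> + \<gamma> \<in> \<Phi>p \<Longrightarrow> min m (u \<beta> + u \<gamma>) \<le> u (\<beta> + \<gamma>)"
    and "set_mset A \<subseteq> \<Phi>p" "set_mset B \<subseteq> {\<beta>\<in>\<Phi>p. u \<beta> < m}"
    and "sum_mset A = sum_mset B" "A \<noteq> {#} \<or> B \<noteq> {#}"
  shows "sum_mset (image_mset u A) < sum_mset (image_mset (\<lambda>\<beta>. u \<beta> + 1) B)"
  using assms(3-6)
proof (induction "size A + size B" arbitrary: A B rule: less_induct)
  case less
  have vpos: "inner v (sum_mset M) > 0" if "set_mset M \<subseteq> \<Phi>p" "M \<noteq> {#}" for M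
    using that
  proof (induction M)
    case (add x M)
    then show ?case using pos_gt[of x] by (cases "M = {#}") (auto simp: inner_add_right add_pos_pos)
  qed simp
  have B: "set_mset B \<subseteq> \<Phi>p" using less.prems by auto
  have w0: "sum_mset A \<noteq> 0"
    using vpos[of A] vpos[of B] less.prems B by (metis inner_zero_right less_irrefl)
  \<comment> \<open>Expanding one factor over \<open>A\<close> gives a root \<open>a\<close> with
    positive product with the common sum. Expanding that sum over \<open>B\<close> then gives
    \<open>b\<close> with \<open>inner a b > 0\<close>.\<close>
  then have "inner (sum_mset A) (sum_mset A) > 0" by simp
  then obtain a where a: "a \<in># A" "inner (sum_mset A) a > 0"
    unfolding inner_sum_mset[of "sum_mset A" A] using sum_mset_pos_imp_elem_pos by blast
  then have "inner a (sum_mset B) > 0" using less.prems(3) by (simp add: inner_commute)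
  then obtain b where b: "b \<in># B" "inner a b > 0"
    unfolding inner_sum_mset using sum_mset_pos_imp_elem_pos by blast
  obtain A' where A': "A = add_mset a A'" using a(1) by (metis mset_add)
  obtain B' where B': "B = add_mset b B'" using b(1) by (metis mset_add)
  have ab: "a \<in> \<Phi>p" "b \<in> \<Phi>p" "u b < m" using a b less.prems by auto
  have s: "a + sum_mset A' = b + sum_mset B'" using less.prems(3) A' B' by simp
  consider "a = b" | "a - b \<in> \<Phi>p" | "b - a \<in> \<Phi>p" using diff_pos_root[OF ab(1,2) b(2)] by blast
  then show ?case
  proof cases
    \<comment> \<open>Cancelling a common root gives strictness even if nothing remains, since
      \<open>B\<close> counts each root with an extra unit.\<close>
    case 1
    show ?thesis
    proof (cases "A' = {#} \<and> B' = {#}")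
      case True
      then show ?thesis using 1 A' B' by simp
    next
      case False
      have "sum_mset (image_mset u A') < sum_mset (image_mset (\<lambda>\<beta>. u \<beta> + 1) B')"
        using less.hyps[of A' B'] False s 1 less.prems A' B' by auto
      then show ?thesis using 1 A' B' by simp
    qed
  next
    \<comment> \<open>Here \<open>a - b\<close> replaces \<open>a\<close>, and \<open>b\<close> is
      dropped; the \<open>+ 1\<close> in \<open>sub\<close> is the unit that \<open>b\<close>
      contributed.\<close>
    case 2
    have "sum_mset (image_mset u (add_mset (a - b) A')) < sum_mset (image_mset (\<lambda>\<beta>. u \<beta> + 1) B')"
    proof (rule less.hyps)
      show "sum_mset (add_mset (a - b) A') = sum_mset B'" using s by (simp add: algebra_simps)
    qed (use 2 less.prems A' B' in auto)
    moreover have "u a \<le> u b + u (a - b) + 1" using sub[of b "a - b"] ab 2 by simp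
    ultimately show ?thesis using A' B' by simp
  next
    case 3
    \<comment> \<open>Since \<open>u b < m\<close>, the truncation in \<open>sup\<close> is
      inactive. It follows that \<open>u (b - a) < m\<close>, so \<open>b - a\<close> may take the
      place of \<open>b\<close> in \<open>B\<close>.\<close>
    have "min m (u a + u (b - a)) \<le> u b" using sup[of a "b - a"] ab 3 by simp
    then have u: "u a + u (b - a) \<le> u b" using ab(3) by simp
    have "sum_mset (image_mset u A') < sum_mset (image_mset (\<lambda>\<beta>. u \<beta> + 1) (add_mset (b - a) B'))"
    proof (rule less.hyps)
      show "sum_mset A' = sum_mset (add_mset (b - a) B')" using s by (simp add: algebra_simps)
    qed (use 3 less.prems A' B' u ab in auto)
    then show ?thesis using A' B' u by simp
  qed
qed

text \<open>Adding the lower bounds over a multiset \<open>A\<close> and the upper bounds over a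
  multiset \<open>B\<close> with the same sum gives the inequality of \<open>level_sum_less\<close>
  as a necessary condition. Gordan's alternative and rounding show that these conditions also
  suffice.\<close>

lemma ex_point_of_level:
  fixes u :: "'a \<Rightarrow> nat"
  assumes sub: "\<And>\<beta> \<gamma>. \<beta> \<in> \<Phi>p \<Longrightarrow> \<gamma> \<in> \<Phi>p \<Longrightarrow> \<beta> + \<gamma> \<in> \<Phi>p \<Longrightarrow> u (\<beta> + \<gamma>) \<le> u \<beta> + u \<gamma> + 1"
    and sup: "\<And>\<beta> \<gamma>. \<beta> \<in> \<Phi>p \<Longrightarrow> \<gamma> \<in> \<Phi>p \<Longrightarrow> \<beta> + \<gamma> \<in> \<Phi>p \<Longrightarrow> min m (u \<beta> + u \<gamma>) \<le> u (\<beta> + \<gamma>)"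
  shows "\<exists>x. \<forall>\<alpha>\<in>\<Phi>p. real (u \<alpha>) < inner \<alpha> x \<and> (u \<alpha> < m \<longrightarrow> inner \<alpha> x < real (u \<alpha>) + 1)"
proof -
  \<comment> \<open>The affine inequalities are homogenized with an extra coordinate
    \<open>t\<close>. The vector \<open>(0, 1)\<close> in \<open>G\<close> forces
    \<open>t > 0\<close>, so that a solution can be divided by \<open>t\<close> at the end.\<close>
  define lo where "lo \<alpha> = (\<alpha>, - real (u \<alpha>))" for \<alpha>
  define hi where "hi \<beta> = (- \<beta>, real (u \<beta>) + 1)" for \<beta>
  define Q where "Q = {\<beta>\<in>\<Phi>p. u \<beta> < m}"
  define G :: "('a \<times> real) set" where "G = lo ` \<Phi>p \<union> hi ` Q \<union> {(0, 1)}"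
  have finG: "finite G" using finite_roots by (auto simp: G_def Q_def)
  have Gcases: "(fst g \<in> \<Phi>p \<and> inner v (fst g) > 0 \<and> snd g = - real (u (fst g))) \<or>
      (- fst g \<in> Q \<and> inner v (fst g) < 0 \<and> snd g = real (u (- fst g)) + 1) \<or> g = (0, 1)" if "g \<in> G" for g
    using that pos_gt by (auto simp: G_def lo_def hi_def Q_def)
  have "\<not> (\<exists>c. (\<forall>g\<in>G. c g \<ge> 0) \<and> sum c G = (1::real) \<and> (\<Sum>g\<in>G. c g *\<^sub>R g) = 0)"
  proof
    assume "\<exists>c. (\<forall>g\<in>G. c g \<ge> 0) \<and> sum c G = (1::real) \<and> (\<Sum>g\<in>G. c g *\<^sub>R g) = 0"
    then obtain c where c: "\<And>g. g \<in> G \<Longrightarrow> c g \<ge> 0" "sum c G = (1::real)" "(\<Sum>g\<in>G. c g *\<^sub>R g) = 0" by blast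
    \<comment> \<open>\<open>D\<close> consists of the coroots and the extra coordinate. Coroots
      pair integrally with roots by the crystallographic condition, and together the elements of
      \<open>D\<close> separate points because the roots span.\<close>
    define D :: "('a \<times> real) set" where "D = (\<lambda>\<alpha>. ((2 / inner \<alpha> \<alpha>) *\<^sub>R \<alpha>, 0)) ` \<Phi> \<union> {(0, 1)}"
    have finD: "finite D" using finite_roots by (simp add: D_def)
    have intD: "inner d g \<in> \<int>" if "d \<in> D" "g \<in> G" for d g
    proof -
      have "fst g \<in> \<Phi> \<or> fst g = 0"
        using Gcases[OF that(2)] pos_subset uminus_root[of "- fst g"] by (auto simp: Q_def)
      moreover have "snd g \<in> \<int>"
        using Gcases[OF that(2)] by auto
      moreover have "(\<exists>\<alpha>\<in>\<Phi>. inner d g = 2 * inner (fst g) \<alpha> / inner \<alpha> \<alpha>) \<or> inner d g = snd g"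
        using that(1) by (cases g) (auto simp: D_def inner_commute)
      ultimately show ?thesis using cartan_int by auto
    qed
    have sepD: "x = 0" if x: "\<And>d. d \<in> D \<Longrightarrow> inner d x = 0" for x
    proof -
      have "snd x = 0" using x[of "(0, 1)"] by (cases x) (auto simp: D_def)
      moreover have "inner (fst x) \<alpha> = 0" if "\<alpha> \<in> \<Phi>" for \<alpha>
      proof -
        have "inner ((2 / inner \<alpha> \<alpha>) *\<^sub>R \<alpha>, 0) x = 0" using that by (intro x) (auto simp: D_def)
        moreover have "\<alpha> \<noteq> 0" using that zero_not_root by blast
        ultimately show ?thesis by (cases x) (auto simp: inner_commute)
      qed
      then have "fst x = 0" using span_roots
        by (metis UNIV_I inner_eq_zero_iff orthogonal_def orthogonal_to_span)
      ultimately show ?thesis by (simp add: prod_eq_iff)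
    qed
    obtain n :: "'a \<times> real \<Rightarrow> nat" where npos: "\<exists>g\<in>G. n g > 0" and n0: "(\<Sum>g\<in>G. real (n g) *\<^sub>R g) = 0"
      using integral_dependence[OF finG finD intD sepD c] by metis
    \<comment> \<open>The sign of the height recovers which generators came from lower bounds and
      which from upper bounds; \<open>(0, 1)\<close> has height 0.\<close>
    define G1 where "G1 = {g\<in>G. inner v (fst g) > 0}"
    define G2 where "G2 = {g\<in>G. inner v (fst g) < 0}"
    have fin12: "finite G1" "finite G2" using finG by (auto simp: G1_def G2_def)
    have G1: "fst g \<in> \<Phi>p" "snd g = - real (u (fst g))" if "g \<in> G1" for g
      using Gcases[of g] that by (auto simp: G1_def)
    have G2: "- fst g \<in> Q" "snd g = real (u (- fst g)) + 1" if "g \<in> G2" for g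
      using Gcases[of g] that by (auto simp: G2_def)
    have Geq: "G = insert (0,1) (G1 \<union> G2)" and disj: "(0,1) \<notin> G1 \<union> G2" "G1 \<inter> G2 = {}"
      using Gcases by (auto simp: G1_def G2_def G_def)
    have split: "sum h G = h (0,1) + (sum h G1 + sum h G2)" for h :: "'a \<times> real \<Rightarrow> 'b::comm_monoid_add"
      using fin12 disj unfolding Geq by (simp add: sum.union_disjoint)
    define A where "A = (\<Sum>g\<in>G1. replicate_mset (n g) (fst g))"
    define B where "B = (\<Sum>g\<in>G2. replicate_mset (n g) (- fst g))"
    have setA: "set_mset A \<subseteq> \<Phi>p" unfolding A_def using fin12 G1 by (auto simp: set_mset_sum)
    have setB: "set_mset B \<subseteq> Q" unfolding B_def using fin12 G2 by (auto simp: set_mset_sum)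
    have sA: "sum_mset A = (\<Sum>g\<in>G1. real (n g) *\<^sub>R fst g)"
      unfolding A_def using sum_mset_sum_replicate[OF fin12(1), of "\<lambda>x. x" n fst] by simp
    have "sum_mset B = (\<Sum>g\<in>G2. real (n g) *\<^sub>R - fst g)"
      unfolding B_def using sum_mset_sum_replicate[OF fin12(2), of "\<lambda>x. x" n "\<lambda>g. - fst g"] by simp
    then have sB: "sum_mset B = - (\<Sum>g\<in>G2. real (n g) *\<^sub>R fst g)" by (simp add: sum_negf)
    have "(\<Sum>g\<in>G. real (n g) *\<^sub>R fst g) = fst (\<Sum>g\<in>G. real (n g) *\<^sub>R g)" by (simp add: fst_sum)
    then have "(\<Sum>g\<in>G1. real (n g) *\<^sub>R fst g) + (\<Sum>g\<in>G2. real (n g) *\<^sub>R fst g) = 0"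
      unfolding n0 split by simp
    then have sumeq: "sum_mset A = sum_mset B" unfolding sA sB by (simp add: eq_neg_iff_add_eq_0)
    have "real (sum_mset (image_mset u A)) = sum_mset (image_mset (\<lambda>x. real (u x)) A)"
      by (rule of_nat_sum_image_mset)
    also have "\<dots> = (\<Sum>g\<in>G1. real (n g) *\<^sub>R real (u (fst g)))"
      unfolding A_def by (rule sum_mset_sum_replicate[OF fin12(1)])
    also have "\<dots> = (\<Sum>g\<in>G1. real (n g) * - snd g)" using G1 by simp
    finally have uA: "real (sum_mset (image_mset u A)) = (\<Sum>g\<in>G1. real (n g) * - snd g)" .
    have "real (sum_mset (image_mset (\<lambda>x. u x + 1) B)) = sum_mset (image_mset (\<lambda>x. real (u x + 1)) B)"
      by (rule of_nat_sum_image_mset)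
    also have "\<dots> = (\<Sum>g\<in>G2. real (n g) *\<^sub>R real (u (- fst g) + 1))"
      unfolding B_def by (rule sum_mset_sum_replicate[OF fin12(2)])
    also have "\<dots> = (\<Sum>g\<in>G2. real (n g) * snd g)" using G2 by (simp add: add.commute)
    finally have uB: "real (sum_mset (image_mset (\<lambda>x. u x + 1) B)) = (\<Sum>g\<in>G2. real (n g) * snd g)" .
    have "(\<Sum>g\<in>G. real (n g) * snd g) = snd (\<Sum>g\<in>G. real (n g) *\<^sub>R g)" by (simp add: snd_sum)
    then have "real (n (0,1)) + ((\<Sum>g\<in>G1. real (n g) * snd g) + (\<Sum>g\<in>G2. real (n g) * snd g)) = 0"
      unfolding n0 split by simp
    then have le: "real (n (0,1)) + real (sum_mset (image_mset (\<lambda>x. u x + 1) B)) = real (sum_mset (image_mset u A))"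
      unfolding uA uB by (simp add: sum_negf)
    \<comment> \<open>Were both empty, only \<open>(0, 1)\<close> could carry weight, and the
      relation \<open>le\<close> between the levels would make that weight zero as well.\<close>
    have "A \<noteq> {#} \<or> B \<noteq> {#}"
    proof (rule ccontr)
      assume "\<not> ?thesis"
      then have e: "A = {#}" "B = {#}" by auto
      have "n g = 0" if "g \<in> G1 \<union> G2" for g
      proof (rule ccontr)
        assume "n g \<noteq> 0"
        then have "fst g \<in># A \<or> - fst g \<in># B"
          using that fin12 unfolding A_def B_def by (auto simp: set_mset_sum)
        then show False using e by simp
      qed
      moreover have "n (0,1) = 0" using le e by simp
      ultimately show False using npos Geq by auto
    qed
    then have "sum_mset (image_mset u A) < sum_mset (image_mset (\<lambda>x. u x + 1) B)"
      by (intro level_sum_less[where m = m]) (use sub sup setA setB sumeq Q_def in auto)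
    then show False using le by linarith
  qed
  moreover have "G \<noteq> {}" by (simp add: G_def)
  ultimately obtain w where w: "\<And>g. g \<in> G \<Longrightarrow> inner w g > 0"
    using gordan[OF finG] by meson
  define t where "t = snd w"
  define x where "x = (1 / t) *\<^sub>R fst w"
  have t: "t > 0" using w[of "(0,1)"] by (cases w) (auto simp: G_def t_def)
  have fx: "fst w = t *\<^sub>R x" using t by (simp add: x_def)
  have w_eq: "inner w g = t * (inner x (fst g) + snd g)" for g
    using fx by (cases w; cases g) (simp add: t_def algebra_simps)
  have pos: "inner x (fst g) + snd g > 0" if "g \<in> G" for g
    using w[OF that] t by (simp add: w_eq zero_less_mult_iff)
  have "real (u \<alpha>) < inner \<alpha> x \<and> (u \<alpha> < m \<longrightarrow> inner \<alpha> x < real (u \<alpha>) + 1)" if "\<alpha> \<in> \<Phi>p" for \<alpha>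
    using pos[of "lo \<alpha>"] pos[of "hi \<alpha>"] that by (auto simp: G_def Q_def lo_def hi_def inner_commute)
  then show ?thesis by blast
qed

text \<open>With \<open>u\<close> the last index at which a root is present, additivity of the
  filters gives the lower estimate for \<open>u (\<beta> + \<gamma>)\<close>. The upper one holds
  because \<open>\<beta>\<close> and \<open>\<gamma>\<close> are absent at indices
  \<open>u \<beta> + 1\<close> and \<open>u \<gamma> + 1\<close>; a larger level of the sum would
  leave room for the condition on complements at the index
  \<open>u \<beta> + u \<gamma> + 2\<close>.\<close>

lemma cell_nonempty:
  assumes g: "geometric_chain \<Phi>p m I"
  shows "cell \<Phi>p m I \<noteq> {}"
proof -
  define u where "u \<alpha> = Max {i. i \<le> m \<and> \<alpha> \<in> I i}" for \<alpha>
  note gd = geometric_chainD[OF g]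
  have umax: "u \<alpha> \<le> m \<and> \<alpha> \<in> I (u \<alpha>)" if "\<alpha> \<in> \<Phi>p" for \<alpha>
  proof -
    have "u \<alpha> \<in> {i. i \<le> m \<and> \<alpha> \<in> I i}" unfolding u_def
      using that gd(1) by (intro Max_in) auto
    then show ?thesis by simp
  qed
  have u: "\<alpha> \<in> I i \<longleftrightarrow> i \<le> u \<alpha>" if "\<alpha> \<in> \<Phi>p" "i \<le> m" for \<alpha> i
  proof
    assume "\<alpha> \<in> I i"
    then show "i \<le> u \<alpha>" unfolding u_def using that by (intro Max_ge) auto
  next
    assume "i \<le> u \<alpha>"
    then show "\<alpha> \<in> I i" using umax that gd(3) by blast
  qed
  have "\<exists>x. \<forall>\<alpha>\<in>\<Phi>p. real (u \<alpha>) < inner \<alpha> x \<and> (u \<alpha> < m \<longrightarrow> inner \<alpha> x < real (u \<alpha>) + 1)"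
  proof (rule ex_point_of_level)
    fix \<beta> \<gamma> assume bc: "\<beta> \<in> \<Phi>p" "\<gamma> \<in> \<Phi>p" "\<beta> + \<gamma> \<in> \<Phi>p"
    show "u (\<beta> + \<gamma>) \<le> u \<beta> + u \<gamma> + 1"
    proof (rule ccontr)
      assume *: "\<not> ?thesis"
      then have le: "(u \<beta> + 1) + (u \<gamma> + 1) \<le> m" using umax[OF bc(3)] by linarith
      then have "\<beta> \<notin> I (u \<beta> + 1)" "\<gamma> \<notin> I (u \<gamma> + 1)" using u bc by auto
      then have "\<beta> + \<gamma> \<notin> I ((u \<beta> + 1) + (u \<gamma> + 1))" using gd(6)[OF le] bc by blast
      then show False using u[OF bc(3) le] * by linarith
    qed
    have "\<beta> + \<gamma> \<in> I (u \<beta> + u \<gamma>)" using gd(5) umax bc by blast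
    then have "\<beta> + \<gamma> \<in> I (min m (u \<beta> + u \<gamma>))" using gd(3) by (meson min.cobounded2 subsetD)
    then show "min m (u \<beta> + u \<gamma>) \<le> u (\<beta> + \<gamma>)" using u[OF bc(3)] by simp
  qed
  then obtain x where x: "\<And>\<alpha>. \<alpha> \<in> \<Phi>p \<Longrightarrow> real (u \<alpha>) < inner \<alpha> x"
     "\<And>\<alpha>. \<alpha> \<in> \<Phi>p \<Longrightarrow> u \<alpha> < m \<Longrightarrow> inner \<alpha> x < real (u \<alpha>) + 1" by blast
  have "x \<in> cell \<Phi>p m I" unfolding cell_def
  proof (intro CollectI ballI allI impI conjI)
    fix \<alpha> i assume a: "\<alpha> \<in> \<Phi>p" "i \<le> m"
    {
      assume "\<alpha> \<in> I i"
      then show "real i < inner \<alpha> x" using u[OF a] x(1)[OF a(1)] by linarith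
    next
      assume "\<alpha> \<notin> I i"
      then have "u \<alpha> < i" using u[OF a] by simp
      then show "inner \<alpha> x < real i" using x(2)[OF a(1)] a by simp
    }
  qed
  then show ?thesis by blast
qed

end

section \<open>Dominant regions\<close>

lemma cell_mem_iff:
  assumes "x \<in> cell \<Phi>p m I" "\<alpha> \<in> \<Phi>p" "i \<le> m"
  shows "\<alpha> \<in> I i \<longleftrightarrow> inner \<alpha> x > real i"
  using assms unfolding cell_def by (auto dest: order_less_asym)

lemma closed_sides_closure:
  assumes "y \<in> closure (cell \<Phi>p m I)" "\<alpha> \<in> \<Phi>p" "i \<le> m"
  shows "\<alpha> \<in> I i \<Longrightarrow> inner \<alpha> y \<ge> real i" "\<alpha> \<notin> I i \<Longrightarrow> inner \<alpha> y \<le> real i"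
proof -
  show "inner \<alpha> y \<ge> real i" if "\<alpha> \<in> I i"
  proof -
    have "cell \<Phi>p m I \<subseteq> {x. inner \<alpha> x \<ge> real i}" using that assms(2,3) by (auto simp: cell_def less_imp_le)
    then have "closure (cell \<Phi>p m I) \<subseteq> {x. inner \<alpha> x \<ge> real i}"
      by (intro closure_minimal closed_halfspace_ge)
    then show ?thesis using assms(1) by blast
  qed
  show "inner \<alpha> y \<le> real i" if "\<alpha> \<notin> I i"
  proof -
    have "cell \<Phi>p m I \<subseteq> {x. inner \<alpha> x \<le> real i}" using that assms(2,3) by (auto simp: cell_def less_imp_le)
    then have "closure (cell \<Phi>p m I) \<subseteq> {x. inner \<alpha> x \<le> real i}"
      by (intro closure_minimal closed_halfspace_le)
    then show ?thesis using assms(1) by blast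
  qed
qed

lemma convex_cell: "convex (cell \<Phi>p m I)"
proof -
  have "cell \<Phi>p m I = (\<Inter>\<alpha>\<in>\<Phi>p. \<Inter>i\<in>{..m}. {x. (\<alpha> \<in> I i \<longrightarrow> inner \<alpha> x > real i) \<and> (\<alpha> \<notin> I i \<longrightarrow> inner \<alpha> x < real i)})"
    by (auto simp: cell_def)
  moreover have "convex {x. (\<alpha> \<in> I i \<longrightarrow> inner \<alpha> x > real i) \<and> (\<alpha> \<notin> I i \<longrightarrow> inner \<alpha> x < real i)}" for \<alpha> i
    by (cases "\<alpha> \<in> I i") (simp_all add: convex_halfspace_gt convex_halfspace_lt)
  ultimately show ?thesis by (auto intro!: convex_INT)
qed

text \<open>A piece of a hyperplane of full dimension has the whole hyperplane as affine hull, and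
  this cannot lie in a hyperplane with a different normal direction. This is the tool for showing
  that something is not a wall.\<close>

lemma aff_dim_hyperplane_Int_less:
  fixes \<alpha> \<beta> :: "'a::euclidean_space"
  assumes a: "\<alpha> \<noteq> 0" and sub: "hyp \<alpha> c \<inter> S \<subseteq> hyp \<beta> d" and np: "\<And>l. \<beta> \<noteq> l *\<^sub>R \<alpha>"
  shows "aff_dim (hyp \<alpha> c \<inter> S) \<noteq> int DIM('a) - 1"
proof
  assume eq: "aff_dim (hyp \<alpha> c \<inter> S) = int DIM('a) - 1"
  have aff: "affine (hyp \<alpha> c)" "affine (hyp \<beta> d)" by (simp_all add: hyp_def affine_hyperplane)
  have "int DIM('a) - 1 > -1" by simp
  then have ne: "hyp \<alpha> c \<inter> S \<noteq> {}" using eq by (metis aff_dim_empty less_irrefl)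
  have "affine hull (hyp \<alpha> c \<inter> S) = hyp \<alpha> c"
  proof (rule affine_dim_equal)
    show "affine hull (hyp \<alpha> c \<inter> S) \<subseteq> hyp \<alpha> c" using aff by (intro hull_minimal) auto
    show "aff_dim (affine hull (hyp \<alpha> c \<inter> S)) = aff_dim (hyp \<alpha> c)"
      using a eq by (simp add: hyp_def)
  qed (use aff ne in auto)
  moreover have "affine hull (hyp \<alpha> c \<inter> S) \<subseteq> hyp \<beta> d" using sub aff by (intro hull_minimal) auto
  ultimately have "hyp \<alpha> c \<subseteq> hyp \<beta> d" by simp
  then show False using hyperplane_subset_parallel[OF a] np unfolding hyp_def by blast
qed

text \<open>A segment joining the two cells crosses the hyperplane in a relatively interior point of a common
  facet.\<close>

lemma facet_of_adjacent:
  fixes \<alpha> :: "'a::euclidean_space"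
  assumes fin: "finite \<Phi>p" and x: "x \<in> cell \<Phi>p m I" and y: "y \<in> cell \<Phi>p m I'" and a: "\<alpha> \<in> \<Phi>p" "\<alpha> \<noteq> 0"
    and same: "\<And>\<beta> i. \<beta> \<in> \<Phi>p \<Longrightarrow> i \<le> m \<Longrightarrow> (\<beta>, i) \<noteq> (\<alpha>, m) \<Longrightarrow> \<beta> \<in> I i \<longleftrightarrow> \<beta> \<in> I' i"
    and flip: "\<alpha> \<in> I m \<longleftrightarrow> \<alpha> \<notin> I' m"
  shows "aff_dim (hyp \<alpha> (real m) \<inter> closure (cell \<Phi>p m I)) = int DIM('a) - 1"
proof -
  define side where "side \<beta> i = (if \<beta> \<in> I i then {z. inner \<beta> z > real i} else {z. inner \<beta> z < real i})" for \<beta> i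
  define X where "X = \<Phi>p \<times> {..m} - {(\<alpha>, m)}"
  \<comment> \<open>\<open>U\<close> keeps every constraint except the one that is flipped. It is
    open, convex and contains both points, so the crossing point of the segment lies in
    \<open>U\<close>.\<close>
  define U where "U = (\<Inter>(\<beta>,i)\<in>X. side \<beta> i)"
  have side: "open (side \<beta> i)" "convex (side \<beta> i)" for \<beta> i
    by (auto simp: side_def open_halfspace_gt open_halfspace_lt convex_halfspace_gt convex_halfspace_lt)
  have "finite X" using fin by (simp add: X_def)
  then have U: "open U" "convex U" unfolding U_def using side by (auto intro!: open_INT convex_INT)
  have cellU: "cell \<Phi>p m I = U \<inter> side \<alpha> m"
    using a(1) by (auto simp: cell_def U_def X_def side_def split: if_splits)
  have xU: "x \<in> U" using x cellU by simp
  have "y \<in> side \<beta> i" if "(\<beta>, i) \<in> X" for \<beta> i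
  proof -
    have b: "\<beta> \<in> \<Phi>p" "i \<le> m" "(\<beta>, i) \<noteq> (\<alpha>, m)" using that by (auto simp: X_def)
    then show ?thesis using y same[OF b] by (auto simp: cell_def side_def)
  qed
  then have yU: "y \<in> U" by (auto simp: U_def)
  have xs: "x \<in> side \<alpha> m" using x cellU by simp
  have "inner \<alpha> x > real m \<and> inner \<alpha> y < real m \<or> inner \<alpha> x < real m \<and> inner \<alpha> y > real m"
    using x y a(1) flip unfolding cell_def by auto
  moreover have "connected (closed_segment x y)" by simp
  ultimately obtain p where p: "p \<in> closed_segment x y" "inner \<alpha> p = real m"
    using connected_ivt_hyperplane[of "closed_segment x y" x y \<alpha> "real m"]
      connected_ivt_hyperplane[of "closed_segment x y" y x \<alpha> "real m"] by fastforce
  have pU: "p \<in> U" using p(1) xU yU U(2) by (meson closed_segment_subset subsetD)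
  \<comment> \<open>Moving from \<open>z\<close> towards \<open>x\<close> leaves the hyperplane at
    once on the side of \<open>x\<close> and stays in \<open>U\<close>, hence runs inside the
    cell.\<close>
  have "z \<in> closure (cell \<Phi>p m I)" if z: "z \<in> U" "inner \<alpha> z = real m" for z
  proof -
    have zx: "z \<noteq> x" using z(2) xs by (auto simp: side_def split: if_splits)
    have "open_segment z x \<subseteq> cell \<Phi>p m I"
    proof
      fix w assume w: "w \<in> open_segment z x"
      then have "w \<in> U" using z(1) xU U(2) by (meson closed_segment_subset open_closed_segment subsetD)
      moreover obtain s where s: "0 < s" "s < 1" "w = (1 - s) *\<^sub>R z + s *\<^sub>R x"
        using w by (auto simp: in_segment)
      have "inner \<alpha> w - real m = s * (inner \<alpha> x - real m)"
        unfolding s(3) inner_add_right inner_scaleR_right z(2) by (simp add: algebra_simps)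
      then have "inner \<alpha> w > real m \<longleftrightarrow> inner \<alpha> x > real m" "inner \<alpha> w < real m \<longleftrightarrow> inner \<alpha> x < real m"
        using s(1) zero_less_mult_pos[of s "inner \<alpha> x - real m"] mult_pos_pos[of s "inner \<alpha> x - real m"]
          mult_less_0_iff[of s "inner \<alpha> x - real m"] by linarith+
      then have "w \<in> side \<alpha> m" using xs by (simp add: side_def split: if_splits)
      ultimately show "w \<in> cell \<Phi>p m I" using cellU by simp
    qed
    then have "closure (open_segment z x) \<subseteq> closure (cell \<Phi>p m I)" by (rule closure_mono)
    then show ?thesis using zx by (auto simp: closure_open_segment)
  qed
  then have sub: "hyp \<alpha> (real m) \<inter> U \<subseteq> hyp \<alpha> (real m) \<inter> closure (cell \<Phi>p m I)" by (auto simp: hyp_def)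
  have hd: "aff_dim (hyp \<alpha> (real m)) = int DIM('a) - 1" using a(2) by (simp add: hyp_def)
  have "aff_dim (hyp \<alpha> (real m) \<inter> U) = aff_dim (hyp \<alpha> (real m))"
    using U(1) p(2) pU by (intro aff_dim_convex_Int_open) (auto simp: hyp_def convex_hyperplane)
  then show ?thesis using hd aff_dim_subset[OF sub] aff_dim_subset[of "hyp \<alpha> (real m) \<inter> closure (cell \<Phi>p m I)" "hyp \<alpha> (real m)"]
    by simp
qed

context positive_roots
begin

text \<open>The threshold \<open>min i m\<close> implements the constant tail of a chain. Additivity
  survives it because \<open>min (i + j) m \<le> min i m + min j m\<close>.\<close>

lemma geometric_chain_of_point:
  assumes pos: "\<And>\<alpha>. \<alpha> \<in> \<Phi>p \<Longrightarrow> inner \<alpha> x > 0"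
    and ne: "\<And>\<alpha> i. \<alpha> \<in> \<Phi>p \<Longrightarrow> i \<le> m \<Longrightarrow> inner \<alpha> x \<noteq> real i"
  defines "I \<equiv> \<lambda>i. {\<alpha>\<in>\<Phi>p. inner \<alpha> x > real (min i m)}"
  shows "geometric_chain \<Phi>p m I" "x \<in> cell \<Phi>p m I"
proof -
  show "geometric_chain \<Phi>p m I"
  proof (rule geometric_chainI)
    show "I 0 = \<Phi>p" using pos by (auto simp: I_def)
    show "\<alpha> + \<beta> \<in> I (i + j)" if "\<alpha> \<in> I i" "\<beta> \<in> I j" "\<alpha> + \<beta> \<in> \<Phi>p" for i j \<alpha> \<beta>
    proof -
      have "real (min (i + j) m) \<le> real (min i m) + real (min j m)" by linarith
      then show ?thesis using that by (auto simp: I_def inner_add_left)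
    qed
    show "\<alpha> + \<beta> \<notin> I (i + j)" if "i + j \<le> m" "\<alpha> \<in> \<Phi>p - I i" "\<beta> \<in> \<Phi>p - I j" for i j \<alpha> \<beta>
      using that by (auto simp: I_def inner_add_left)
  qed (auto simp: I_def)
  show "x \<in> cell \<Phi>p m I"
    using ne by (fastforce simp: I_def cell_def not_less le_less)
qed

section \<open>Cells as dominant components of the complement\<close>

lemma cell_disjoint_arrangement:
  assumes "x \<in> cell \<Phi>p m I" "I 0 = \<Phi>p"
  shows "x \<notin> \<Union>(arrangement \<Phi> m)"
proof
  assume "x \<in> \<Union>(arrangement \<Phi> m)"
  then obtain \<alpha> k where a: "\<alpha> \<in> \<Phi>" "k \<le> m" "inner \<alpha> x = real k" by (auto simp: arrangement_def hyp_def)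
  have sides: "inner \<beta> x \<noteq> real i" "inner \<beta> x > 0" if "\<beta> \<in> \<Phi>p" "i \<le> m" for \<beta> i
    using assms that unfolding cell_def by fastforce+
  show False
    using root_pos_or_neg[OF a(1)]
  proof
    \<comment> \<open>The arrangement also contains hyperplanes of negative roots at levels
      \<open>k \<ge> 0\<close>; these miss the open dominant chamber.\<close>
    assume "- \<alpha> \<in> \<Phi>p"
    then have "inner (- \<alpha>) x > 0" using sides(2) a(2) by blast
    then show False using a(3) by simp
  qed (use sides(1) a in blast)
qed

text \<open>A cell is convex and avoids the arrangement. Conversely, a connected set avoiding a
  hyperplane stays on one side of it, and the sides determine the cell.\<close>

lemma component_eq_cell:
  assumes x: "x \<in> cell \<Phi>p m I" and i0: "I 0 = \<Phi>p"
  shows "connected_component_set (UNIV - \<Union>(arrangement \<Phi> m)) x = cell \<Phi>p m I" (is "?C = _")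
proof
  show "cell \<Phi>p m I \<subseteq> ?C"
    using x convex_connected[OF convex_cell] cell_disjoint_arrangement[where I = I, OF _ i0]
    by (intro connected_component_maximal) auto
  show "?C \<subseteq> cell \<Phi>p m I"
  proof
    fix y assume y: "y \<in> ?C"
    have C: "connected ?C" "?C \<subseteq> UNIV - \<Union>(arrangement \<Phi> m)"
      by (rule connected_connected_component, rule connected_component_subset)
    have xC: "x \<in> ?C" using x cell_disjoint_arrangement[where I = I, OF _ i0] by (simp add: connected_component_refl)
    have avoid: "inner \<alpha> z \<noteq> real i" if "\<alpha> \<in> \<Phi>p" "i \<le> m" "z \<in> ?C" for \<alpha> i z
    proof
      assume "inner \<alpha> z = real i"
      then have "z \<in> \<Union>(arrangement \<Phi> m)" using that pos_subset by (auto simp: arrangement_def hyp_def)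
      then show False using that(3) C(2) by blast
    qed
    have iff: "inner \<alpha> y > real i \<longleftrightarrow> inner \<alpha> x > real i" if a: "\<alpha> \<in> \<Phi>p" "i \<le> m" for \<alpha> i
    proof (rule ccontr)
      assume "\<not> ?thesis"
      then have "\<exists>z\<in>?C. inner \<alpha> z = real i"
        using connected_ivt_hyperplane[OF C(1) xC y, of \<alpha> "real i"]
          connected_ivt_hyperplane[OF C(1) y xC, of \<alpha> "real i"] by fastforce
      then show False using avoid a by blast
    qed
    have "inner \<alpha> y < real i \<longleftrightarrow> inner \<alpha> x < real i" if a: "\<alpha> \<in> \<Phi>p" "i \<le> m" for \<alpha> i
      using avoid[OF a y] avoid[OF a xC] iff[OF a] by (metis linorder_neqE_linordered_idom order_less_asym)
    with iff show "y \<in> cell \<Phi>p m I" using x by (simp add: cell_def)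
  qed
qed

text \<open>A chain can be read off from any point of its cell, so injectivity rests on
  \<open>cell_nonempty\<close>; surjectivity takes the chain of any point of the region.\<close>

lemma bij_betw_cell:
  "bij_betw (cell \<Phi>p m) {I. geometric_chain \<Phi>p m I} {R \<in> regions \<Phi> m. dominant \<Phi>p R}"
  unfolding bij_betw_def
proof (intro conjI equalityI subsetI)
  show "inj_on (cell \<Phi>p m) {I. geometric_chain \<Phi>p m I}"
  proof (rule inj_onI, clarify)
    fix I I' assume g: "geometric_chain \<Phi>p m I" "geometric_chain \<Phi>p m I'" and eq: "cell \<Phi>p m I = cell \<Phi>p m I'"
    obtain x where x: "x \<in> cell \<Phi>p m I" "x \<in> cell \<Phi>p m I'" using cell_nonempty[OF g(1)] eq by auto
    have le: "I i = I' i" if i: "i \<le> m" for i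
    proof -
      have "\<alpha> \<in> I i \<longleftrightarrow> \<alpha> \<in> I' i" if a: "\<alpha> \<in> \<Phi>p" for \<alpha>
        unfolding cell_mem_iff[OF x(1) a i] cell_mem_iff[OF x(2) a i] ..
      then show ?thesis using geometric_chainD(2)[OF g(1), of i] geometric_chainD(2)[OF g(2), of i] by blast
    qed
    show "I = I'"
    proof
      fix i show "I i = I' i"
        using le[of i] le[of m] geometric_chainD(4)[OF g(1), of i] geometric_chainD(4)[OF g(2), of i]
        by (cases "i \<le> m") auto
    qed
  qed
next
  fix R assume "R \<in> cell \<Phi>p m ` {I. geometric_chain \<Phi>p m I}"
  then obtain I where I: "geometric_chain \<Phi>p m I" "R = cell \<Phi>p m I" by blast
  note i0 = geometric_chainD(1)[OF I(1)]
  obtain x where x: "x \<in> R" using cell_nonempty[OF I(1)] I(2) by blast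
  have "R \<in> regions \<Phi> m" unfolding regions_def components_def
    using component_eq_cell[OF x[unfolded I(2)] i0] cell_disjoint_arrangement[OF x[unfolded I(2)] i0] I(2) by blast
  moreover have "dominant \<Phi>p R"
    using I(2) i0 cell_mem_iff[of _ \<Phi>p m I _ 0] by (auto simp: dominant_def)
  ultimately show "R \<in> {R \<in> regions \<Phi> m. dominant \<Phi>p R}" by simp
next
  fix R assume "R \<in> {R \<in> regions \<Phi> m. dominant \<Phi>p R}"
  then obtain x where x: "x \<notin> \<Union>(arrangement \<Phi> m)" "R = connected_component_set (UNIV - \<Union>(arrangement \<Phi> m)) x"
    and dom: "dominant \<Phi>p R" by (auto simp: regions_def components_def)
  have xR: "x \<in> R" using x by (simp add: connected_component_refl)
  have pos: "inner \<alpha> x > 0" if "\<alpha> \<in> \<Phi>p" for \<alpha> using dom xR that by (auto simp: dominant_def)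
  have ne: "inner \<alpha> x \<noteq> real i" if "\<alpha> \<in> \<Phi>p" "i \<le> m" for \<alpha> i
    using x(1) that pos_subset by (auto simp: arrangement_def hyp_def)
  define I where "I = (\<lambda>i. {\<alpha>\<in>\<Phi>p. inner \<alpha> x > real (min i m)})"
  have I: "geometric_chain \<Phi>p m I" "x \<in> cell \<Phi>p m I"
    using geometric_chain_of_point[OF pos ne] unfolding I_def by simp_all
  then have "R = cell \<Phi>p m I" using component_eq_cell[OF I(2)] geometric_chainD(1)[OF I(1)] x(2) by simp
  then show "R \<in> cell \<Phi>p m ` {I. geometric_chain \<Phi>p m I}" using I by blast
qed

end

section \<open>Walls\<close>

text \<open>These conditions say exactly that adjoining \<open>\<alpha>\<close> to \<open>I m\<close> gives again a geometric chain. The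
  difference \<open>m - 1\<close> is only meant for \<open>m \<ge> 1\<close>.\<close>

definition flippable :: "'a::euclidean_space set \<Rightarrow> nat \<Rightarrow> (nat \<Rightarrow> 'a set) \<Rightarrow> 'a set" where
  "flippable \<Phi>p m I = {\<alpha>\<in>\<Phi>p. \<alpha> \<in> I (m - 1) \<and> \<alpha> \<notin> I m \<and>
     (\<forall>i j. i + j = m \<longrightarrow> \<alpha> \<notin> setsum (\<Phi>p - I i) (\<Phi>p - I j)) \<and>
     (\<forall>\<gamma>\<in>\<Phi>p. \<alpha> + \<gamma> \<in> \<Phi>p \<longrightarrow> \<alpha> + \<gamma> \<in> I m)}"

definition change_top :: "nat \<Rightarrow> (nat \<Rightarrow> 'a set) \<Rightarrow> 'a set \<Rightarrow> nat \<Rightarrow> 'a set" where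
  "change_top m I X i = (if i < m then I i else X)"

lemma change_top_simps [simp]:
  "i < m \<Longrightarrow> change_top m I X i = I i" "m \<le> i \<Longrightarrow> change_top m I X i = X"
  by (simp_all add: change_top_def)

lemma indecomposableD:
  assumes "indecomposable \<Phi>p m I \<alpha>"
  shows "\<alpha> \<in> I m" "i + j = m \<Longrightarrow> \<beta> \<in> I i \<Longrightarrow> \<gamma> \<in> I j \<Longrightarrow> \<alpha> \<noteq> \<beta> + \<gamma>"
  using assms unfolding indecomposable_def by blast+

section \<open>Changing the top filter of a chain\<close>

context positive_roots
begin

text \<open>Only additivity is at risk, by a sum landing in \<open>T\<close>. Indecomposability with
  respect to the larger original filters rules this out for all of \<open>T\<close> at once.\<close>

lemma lower_geometric:
  assumes g: "geometric_chain \<Phi>p m I" and m: "m \<ge> 1" and T: "\<And>\<alpha>. \<alpha> \<in> T \<Longrightarrow> indecomposable \<Phi>p m I \<alpha>"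
  shows "geometric_chain \<Phi>p m (change_top m I (I m - T))" (is "geometric_chain \<Phi>p m ?J")
proof (rule geometric_chainI)
  note gd = geometric_chainD[OF g]
  have J: "?J i \<subseteq> I i" for i using gd(4)[of i] by (cases i m rule: linorder_cases) auto
  show "?J 0 = \<Phi>p" using m gd(1) by simp
  show "?J (Suc i) \<subseteq> ?J i" if "i < m" for i
    using J[of "Suc i"] gd(3)[of i "Suc i"] that by auto
  show "?J i = ?J m" if "i > m" for i using that by simp
  show "\<alpha> + \<beta> \<in> ?J (i + j)" if "\<alpha> \<in> ?J i" "\<beta> \<in> ?J j" "\<alpha> + \<beta> \<in> \<Phi>p" for i j \<alpha> \<beta>
  proof -
    have ab: "\<alpha> \<in> I i" "\<beta> \<in> I j" using that J by auto
    then have s: "\<alpha> + \<beta> \<in> I (i + j)" using gd(5) that(3) by blast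
    show ?thesis
    proof (cases "i + j < m")
      case True
      then show ?thesis using s by simp
    next
      case False
      \<comment> \<open>Indecomposability speaks of index sums equal to \<open>m\<close>. Since the
        filters decrease, the indices can be trimmed until they add up to \<open>m\<close>.\<close>
      define i' where "i' = min i m"
      define j' where "j' = m - i'"
      have ij: "i' + j' = m" "i' \<le> i" "j' \<le> j" using False by (auto simp: i'_def j'_def)
      have "\<alpha> \<in> I i'" "\<beta> \<in> I j'" using ab gd(3)[OF ij(2)] gd(3)[OF ij(3)] by auto
      then have "\<alpha> + \<beta> \<notin> T" using indecomposableD(2)[OF T ij(1)] by blast
      moreover have "\<alpha> + \<beta> \<in> I m" using s gd(3)[of m "i + j"] False by auto
      ultimately show ?thesis using False by simp
    qed
  qed
  show "\<alpha> + \<beta> \<notin> ?J (i + j)"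
    if le: "i + j \<le> m" and ab: "\<alpha> \<in> \<Phi>p - ?J i" "\<beta> \<in> \<Phi>p - ?J j" for i j \<alpha> \<beta>
  proof (cases "i = m \<or> j = m")
    case True
    \<comment> \<open>An index \<open>m\<close> leaves 0 for the other one, and nothing lies outside
      the filter at index 0.\<close>
    then have "i = 0 \<or> j = 0" using le m by auto
    then show ?thesis using ab m gd(1) by auto
  next
    case False
    then have "\<alpha> \<in> \<Phi>p - I i" "\<beta> \<in> \<Phi>p - I j" using le ab by auto
    then show ?thesis using gd(6)[OF le] J by blast
  qed
qed

text \<open>The conditions in \<open>flippable\<close> refer to the old chain. Enlarging
  \<open>I m\<close> only shrinks complements and keeps the sums \<open>\<alpha> + \<gamma>\<close>
  inside, so the roots of \<open>T\<close> do not interfere.\<close>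

lemma raise_geometric:
  assumes g: "geometric_chain \<Phi>p m I" and m: "m \<ge> 1" and T: "T \<subseteq> flippable \<Phi>p m I"
  shows "geometric_chain \<Phi>p m (change_top m I (I m \<union> T))" (is "geometric_chain \<Phi>p m ?J")
proof (rule geometric_chainI)
  note gd = geometric_chainD[OF g]
  have TD: "\<alpha> \<in> \<Phi>p" "\<alpha> \<in> I (m - 1)" "\<And>\<gamma>. \<gamma> \<in> \<Phi>p \<Longrightarrow> \<alpha> + \<gamma> \<in> \<Phi>p \<Longrightarrow> \<alpha> + \<gamma> \<in> I m"
    "\<And>i j. i + j = m \<Longrightarrow> \<alpha> \<notin> setsum (\<Phi>p - I i) (\<Phi>p - I j)" if "\<alpha> \<in> T" for \<alpha>
    using T that unfolding flippable_def by blast+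
  have J: "I i \<subseteq> ?J i" for i using gd(4)[of i] by (cases i m rule: linorder_cases) auto
  have JT: "?J i \<subseteq> I i \<union> T" for i using gd(4)[of i] by (cases i m rule: linorder_cases) auto
  have JP: "?J i \<subseteq> \<Phi>p" for i using JT[of i] gd(2)[of i] TD(1) by blast
  show "?J 0 = \<Phi>p" using m gd(1) by simp
  show "?J (Suc i) \<subseteq> ?J i" if "i < m" for i
  proof (cases "Suc i = m")
    case True
    then show ?thesis using that gd(3)[of i m] TD(2) by auto
  next
    case False
    then show ?thesis using that gd(3)[of i "Suc i"] by simp
  qed
  show "?J i = ?J m" if "i > m" for i using that by simp
  show "\<alpha> + \<beta> \<in> ?J (i + j)" if ab: "\<alpha> \<in> ?J i" "\<beta> \<in> ?J j" "\<alpha> + \<beta> \<in> \<Phi>p" for i j \<alpha> \<beta>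
  proof (cases "\<alpha> \<in> I i \<and> \<beta> \<in> I j")
    case True
    then show ?thesis using gd(5) ab(3) J by blast
  next
    case False
    then have "i \<ge> m \<or> j \<ge> m" using ab by (auto simp: change_top_def split: if_splits)
    then have "m \<le> i + j" by auto
    moreover have "\<alpha> + \<beta> \<in> I m"
    proof -
      have "\<alpha> \<in> T \<or> \<beta> \<in> T" using ab False JT by blast
      then show ?thesis using TD(3)[of \<alpha> \<beta>] TD(3)[of \<beta> \<alpha>] ab JP by (auto simp: add.commute)
    qed
    ultimately show ?thesis by simp
  qed
  show "\<alpha> + \<beta> \<notin> ?J (i + j)"
    if le: "i + j \<le> m" and ab: "\<alpha> \<in> \<Phi>p - ?J i" "\<beta> \<in> \<Phi>p - ?J j" for i j \<alpha> \<beta>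
  proof -
    have ab': "\<alpha> \<in> \<Phi>p - I i" "\<beta> \<in> \<Phi>p - I j" using ab J by auto
    then have n: "\<alpha> + \<beta> \<notin> I (i + j)" using gd(6)[OF le] by blast
    show ?thesis
    proof (cases "i + j = m")
      case True
      then have "\<alpha> + \<beta> \<notin> T" using TD(4)[OF _ True] ab' unfolding setsum_def by blast
      then show ?thesis using n True by simp
    next
      case False
      then show ?thesis using n le by simp
    qed
  qed
qed

text \<open>Every decomposition would force \<open>\<alpha> \<in> I m\<close>: by the last condition
  of \<open>flippable\<close> if a summand at index \<open>m\<close> is new, by the filter property
  if it is old, and by additivity if both indices are below \<open>m\<close>.\<close>

lemma indecomposable_raise:
  assumes g: "geometric_chain \<Phi>p m I" and m: "m \<ge> 1" and T: "T \<subseteq> flippable \<Phi>p m I" and a: "\<alpha> \<in> T"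
  shows "indecomposable \<Phi>p m (change_top m I (I m \<union> T)) \<alpha>" (is "indecomposable \<Phi>p m ?J \<alpha>")
  unfolding indecomposable_def
proof (intro conjI allI impI notI)
  note gd = geometric_chainD[OF g]
  show "\<alpha> \<in> ?J m" using a by simp
  fix i j \<beta> \<gamma> assume ij: "i + j = m" and b: "\<beta> \<in> ?J i" and c: "\<gamma> \<in> ?J j" and eq: "\<alpha> = \<beta> + \<gamma>"
  have aP: "\<alpha> \<in> \<Phi>p" "\<alpha> \<notin> I m" using a T by (auto simp: flippable_def)
  have no: False if x: "x \<in> I m \<union> T" and y: "y \<in> \<Phi>p" and xy: "\<alpha> = x + y" for x y
  proof (cases "x \<in> T")
    case True
    then show False using T y xy aP by (auto simp: flippable_def)
  next
    case False
    then have "x + y \<in> I (m + 0)" using gd(5)[of x m y 0] gd(1) x y xy aP by simp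
    then show False using xy aP by simp
  qed
  have JP: "?J i \<subseteq> \<Phi>p" for i using geometric_chainD(2)[OF raise_geometric[OF g m T]] .
  consider "i = m" | "j = m" | "i < m" "j < m" using ij by linarith
  then show False
  proof cases
    case 1
    then show ?thesis using no[of \<beta> \<gamma>] b c eq JP by auto
  next
    case 2
    then show ?thesis using no[of \<gamma> \<beta>] b c eq JP by (auto simp: add.commute)
  next
    case 3
    then have "\<beta> + \<gamma> \<in> I (i + j)" using gd(5) b c eq aP by simp
    then show ?thesis using ij eq aP by simp
  qed
qed

text \<open>A sum \<open>\<alpha> + \<gamma>\<close> with \<open>\<alpha> \<in> I m\<close> is
  decomposable through the indices \<open>m\<close> and 0. It is therefore not among the removed
  roots, which gives the last condition of \<open>flippable\<close>.\<close>

lemma flippable_lower: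
  assumes g: "geometric_chain \<Phi>p m I" and m: "m \<ge> 1" and T: "\<And>\<alpha>. \<alpha> \<in> T \<Longrightarrow> indecomposable \<Phi>p m I \<alpha>"
  shows "T \<subseteq> flippable \<Phi>p m (change_top m I (I m - T))" (is "T \<subseteq> flippable \<Phi>p m ?J")
proof
  note gd = geometric_chainD[OF g]
  fix \<alpha> assume a: "\<alpha> \<in> T"
  note ind = indecomposableD[OF T[OF a]]
  have aP: "\<alpha> \<in> \<Phi>p" using ind(1) gd(2) by blast
  have "\<alpha> \<in> ?J (m - 1)" using ind(1) gd(3)[of "m - 1" m] m by auto
  moreover have "\<alpha> \<notin> ?J m" using a by simp
  moreover have "\<alpha> \<notin> setsum (\<Phi>p - ?J i) (\<Phi>p - ?J j)" if ij: "i + j = m" for i j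
  proof
    assume "\<alpha> \<in> setsum (\<Phi>p - ?J i) (\<Phi>p - ?J j)"
    then obtain \<beta> \<gamma> where bc: "\<beta> \<in> \<Phi>p - ?J i" "\<gamma> \<in> \<Phi>p - ?J j" "\<alpha> = \<beta> + \<gamma>" by (auto simp: setsum_def)
    have "?J 0 = \<Phi>p" using m gd(1) by simp
    then have "i \<noteq> 0" "j \<noteq> 0" using bc(1,2) by (metis Diff_iff)+
    then have "i < m" "j < m" using ij by auto
    then have "\<beta> + \<gamma> \<notin> I (i + j)" using gd(6)[of i j] bc ij by auto
    then show False using ij bc(3) ind(1) by simp
  qed
  moreover have "\<alpha> + \<gamma> \<in> ?J m" if c: "\<gamma> \<in> \<Phi>p" "\<alpha> + \<gamma> \<in> \<Phi>p" for \<gamma>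
  proof -
    have "\<alpha> + \<gamma> \<in> I m" using gd(5)[of \<alpha> m \<gamma> 0] ind(1) gd(1) c by simp
    moreover have "\<alpha> + \<gamma> \<notin> T" using indecomposableD(2)[OF T, of "\<alpha> + \<gamma>" m 0] ind(1) gd(1) c by auto
    ultimately show ?thesis by simp
  qed
  ultimately show "\<alpha> \<in> flippable \<Phi>p m ?J" using aP unfolding flippable_def by blast
qed

section \<open>Facets on the hyperplanes of level \<open>m\<close>\<close>

lemma pos_not_parallel: "\<alpha> \<in> \<Phi>p \<Longrightarrow> \<beta> \<in> \<Phi>p \<Longrightarrow> \<beta> \<noteq> \<alpha> \<Longrightarrow> \<beta> \<noteq> l *\<^sub>R \<alpha>"
  using pos_parallel by blast

text \<open>If \<open>\<alpha> = \<beta> + \<gamma>\<close> with index sum \<open>m\<close>, the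
  lower bounds for \<open>\<beta>\<close> and \<open>\<gamma>\<close> become equalities on the face,
  which then lies in a second hyperplane. Otherwise, removing \<open>\<alpha>\<close> alone from
  \<open>I m\<close> gives the cell across the wall.\<close>

lemma facet_iff_indecomposable:
  assumes g: "geometric_chain \<Phi>p m I" and m: "m \<ge> 1" and a: "\<alpha> \<in> I m"
  shows "aff_dim (hyp \<alpha> (real m) \<inter> closure (cell \<Phi>p m I)) = int DIM('a) - 1 \<longleftrightarrow> indecomposable \<Phi>p m I \<alpha>"
proof
  note gd = geometric_chainD[OF g]
  have aP: "\<alpha> \<in> \<Phi>p" using a gd(2) by blast
  assume dim: "aff_dim (hyp \<alpha> (real m) \<inter> closure (cell \<Phi>p m I)) = int DIM('a) - 1"
  show "indecomposable \<Phi>p m I \<alpha>"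
    unfolding indecomposable_def
  proof (intro conjI allI impI notI)
    fix i j \<beta> \<gamma> assume ij: "i + j = m" and b: "\<beta> \<in> I i" and c: "\<gamma> \<in> I j" and eq: "\<alpha> = \<beta> + \<gamma>"
    have bP: "\<beta> \<in> \<Phi>p" "\<gamma> \<in> \<Phi>p" using b c gd(2) by auto
    have "\<beta> \<noteq> \<alpha>" using eq pos_nonzero[OF bP(2)] by simp
    moreover have "hyp \<alpha> (real m) \<inter> closure (cell \<Phi>p m I) \<subseteq> hyp \<beta> (real i)"
    proof
      fix y assume y: "y \<in> hyp \<alpha> (real m) \<inter> closure (cell \<Phi>p m I)"
      then have "inner \<beta> y \<ge> real i" "inner \<gamma> y \<ge> real j"
        using closed_sides_closure(1) bP b c ij by (metis IntD2 le_add1 le_add2)+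
      moreover have "inner \<beta> y + inner \<gamma> y = real i + real j"
        using y eq ij by (auto simp: hyp_def inner_add_left)
      ultimately show "y \<in> hyp \<beta> (real i)" by (simp add: hyp_def)
    qed
    ultimately show False
      using aff_dim_hyperplane_Int_less[OF pos_nonzero[OF aP]] pos_not_parallel[OF aP bP(1)] dim by blast
  qed (rule a)
next
  note gd = geometric_chainD[OF g]
  have aP: "\<alpha> \<in> \<Phi>p" using a gd(2) by blast
  assume ind: "indecomposable \<Phi>p m I \<alpha>"
  let ?J = "change_top m I (I m - {\<alpha>})"
  have "geometric_chain \<Phi>p m ?J" using lower_geometric[OF g m, of "{\<alpha>}"] ind by simp
  then obtain x y where x: "x \<in> cell \<Phi>p m I" "y \<in> cell \<Phi>p m ?J" using cell_nonempty g by (meson equals0I)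
  show "aff_dim (hyp \<alpha> (real m) \<inter> closure (cell \<Phi>p m I)) = int DIM('a) - 1"
    by (rule facet_of_adjacent[OF finite_roots(2) x aP pos_nonzero[OF aP]])
       (use a in \<open>auto simp: change_top_def\<close>)
qed

text \<open>Each failing condition of \<open>flippable\<close> makes the face too small: it is
  empty, or upper bounds for two summands become equalities, or some \<open>\<gamma>\<close>
  vanishes on it. If all conditions hold, adding \<open>\<alpha>\<close> alone gives the cell across
  the wall.\<close>

lemma facet_iff_flippable:
  assumes g: "geometric_chain \<Phi>p m I" and m: "m \<ge> 1" and a: "\<alpha> \<in> \<Phi>p" "\<alpha> \<notin> I m"
  shows "aff_dim (hyp \<alpha> (real m) \<inter> closure (cell \<Phi>p m I)) = int DIM('a) - 1 \<longleftrightarrow> \<alpha> \<in> flippable \<Phi>p m I"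
proof
  note gd = geometric_chainD[OF g]
  assume dim: "aff_dim (hyp \<alpha> (real m) \<inter> closure (cell \<Phi>p m I)) = int DIM('a) - 1"
  have no: False if "\<beta> \<in> \<Phi>p" "\<beta> \<noteq> \<alpha>" "hyp \<alpha> (real m) \<inter> closure (cell \<Phi>p m I) \<subseteq> hyp \<beta> d" for \<beta> d
    using aff_dim_hyperplane_Int_less[OF pos_nonzero[OF a(1)] that(3)] pos_not_parallel[OF a(1) that(1,2)] dim by blast
  have "\<alpha> \<in> I (m - 1)"
  proof (rule ccontr)
    assume "\<alpha> \<notin> I (m - 1)"
    then have "inner \<alpha> y \<le> real (m - 1)" if "y \<in> closure (cell \<Phi>p m I)" for y
      using closed_sides_closure(2)[OF that a(1)] by simp
    then have "hyp \<alpha> (real m) \<inter> closure (cell \<Phi>p m I) = {}" using m by (fastforce simp: hyp_def)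
    then show False using dim by simp
  qed
  moreover have "\<alpha> \<notin> setsum (\<Phi>p - I i) (\<Phi>p - I j)" if ij: "i + j = m" for i j
  proof
    assume "\<alpha> \<in> setsum (\<Phi>p - I i) (\<Phi>p - I j)"
    then obtain \<beta> \<gamma> where bc: "\<beta> \<in> \<Phi>p" "\<beta> \<notin> I i" "\<gamma> \<in> \<Phi>p" "\<gamma> \<notin> I j" and eq: "\<alpha> = \<beta> + \<gamma>" by (auto simp: setsum_def)
    have "hyp \<alpha> (real m) \<inter> closure (cell \<Phi>p m I) \<subseteq> hyp \<beta> (real i)"
    proof
      fix y assume y: "y \<in> hyp \<alpha> (real m) \<inter> closure (cell \<Phi>p m I)"
      then have "inner \<beta> y \<le> real i" "inner \<gamma> y \<le> real j"
        using closed_sides_closure(2) bc ij by (metis IntD2 le_add1 le_add2)+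
      moreover have "inner \<beta> y + inner \<gamma> y = real i + real j"
        using y eq ij by (auto simp: hyp_def inner_add_left)
      ultimately show "y \<in> hyp \<beta> (real i)" by (simp add: hyp_def)
    qed
    moreover have "\<beta> \<noteq> \<alpha>" using eq pos_nonzero[OF bc(3)] by simp
    ultimately show False using no bc by blast
  qed
  moreover have "\<alpha> + \<gamma> \<in> I m" if c: "\<gamma> \<in> \<Phi>p" "\<alpha> + \<gamma> \<in> \<Phi>p" for \<gamma>
  proof (rule ccontr)
    assume n: "\<alpha> + \<gamma> \<notin> I m"
    have "hyp \<alpha> (real m) \<inter> closure (cell \<Phi>p m I) \<subseteq> hyp \<gamma> 0"
    proof
      fix y assume y: "y \<in> hyp \<alpha> (real m) \<inter> closure (cell \<Phi>p m I)"
      then have "inner (\<alpha> + \<gamma>) y \<le> real m" using closed_sides_closure(2)[where I = I, OF _ c(2) order_refl n] by blast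
      moreover have "inner \<gamma> y \<ge> real 0" using closed_sides_closure(1)[of y \<Phi>p m I \<gamma> 0] y gd(1) c(1) by auto
      ultimately show "y \<in> hyp \<gamma> 0" using y by (auto simp: hyp_def inner_add_left)
    qed
    \<comment> \<open>Otherwise \<open>\<alpha> + \<gamma>\<close> would be twice a root, against
      reducedness.\<close>
    moreover have "\<gamma> \<noteq> \<alpha>"
      using pos_parallel[OF c(1,2), of 2] pos_nonzero[OF c(1)] by (auto simp: scaleR_2)
    ultimately show False using no c by blast
  qed
  ultimately show "\<alpha> \<in> flippable \<Phi>p m I" using a unfolding flippable_def by blast
next
  note gd = geometric_chainD[OF g]
  assume fl: "\<alpha> \<in> flippable \<Phi>p m I"
  let ?J = "change_top m I (I m \<union> {\<alpha>})"
  have "geometric_chain \<Phi>p m ?J" using raise_geometric[OF g m, of "{\<alpha>}"] fl by simp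
  then obtain x y where x: "x \<in> cell \<Phi>p m I" "y \<in> cell \<Phi>p m ?J" using cell_nonempty g by (meson equals0I)
  show "aff_dim (hyp \<alpha> (real m) \<inter> closure (cell \<Phi>p m I)) = int DIM('a) - 1"
    by (rule facet_of_adjacent[OF finite_roots(2) x a(1) pos_nonzero[OF a(1)]])
       (use a in \<open>auto simp: change_top_def\<close>)
qed

text \<open>Flippable roots are pairwise obtuse: if \<open>\<alpha> - \<beta>\<close> were a positive root, then
  \<open>\<alpha> = \<beta> + (\<alpha> - \<beta>)\<close> would lie in \<open>I m\<close>.\<close>

lemma card_flippable: "card (flippable \<Phi>p m I) \<le> DIM('a)"
proof -
  have fin: "finite (flippable \<Phi>p m I)" using finite_roots(2) by (auto simp: flippable_def)
  have no: "\<alpha> - \<beta> \<notin> \<Phi>p" if "\<alpha> \<in> flippable \<Phi>p m I" "\<beta> \<in> flippable \<Phi>p m I" for \<alpha> \<beta>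
  proof
    assume "\<alpha> - \<beta> \<in> \<Phi>p"
    then have "\<beta> + (\<alpha> - \<beta>) \<in> I m" using that unfolding flippable_def by fastforce
    then show False using that by (simp add: flippable_def)
  qed
  have "inner \<alpha> \<beta> \<le> 0" if "\<alpha> \<in> flippable \<Phi>p m I" "\<beta> \<in> flippable \<Phi>p m I" "\<alpha> \<noteq> \<beta>" for \<alpha> \<beta>
    using diff_pos_root[of \<alpha> \<beta>] no that by (fastforce simp: flippable_def)
  then have "independent (flippable \<Phi>p m I)"
    using independent_obtuse[OF fin, of v] pos_gt by (auto simp: flippable_def)
  then show ?thesis using independent_bound by blast
qed

end

section \<open>Highest root and fundamental alcove\<close>

context positive_roots
begin

lemma root_le_refl: "root_le \<Phi>p \<alpha> \<alpha>"
  unfolding root_le_def by (intro exI[of _ "\<lambda>_. 0"]) simp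

lemma root_le_trans:
  assumes "root_le \<Phi>p \<alpha> \<beta>" "root_le \<Phi>p \<beta> \<gamma>"
  shows "root_le \<Phi>p \<alpha> \<gamma>"
proof -
  obtain c d where c: "\<forall>\<delta>\<in>\<Phi>p. c \<delta> \<ge> (0::real)" "\<beta> - \<alpha> = (\<Sum>\<delta>\<in>\<Phi>p. c \<delta> *\<^sub>R \<delta>)"
    and d: "\<forall>\<delta>\<in>\<Phi>p. d \<delta> \<ge> (0::real)" "\<gamma> - \<beta> = (\<Sum>\<delta>\<in>\<Phi>p. d \<delta> *\<^sub>R \<delta>)"
    using assms unfolding root_le_def by blast
  have "\<gamma> - \<alpha> = (\<beta> - \<alpha>) + (\<gamma> - \<beta>)" by simp
  also have "\<dots> = (\<Sum>\<delta>\<in>\<Phi>p. (c \<delta> + d \<delta>) *\<^sub>R \<delta>)" unfolding c(2) d(2) by (simp add: scaleR_add_left sum.distrib)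
  finally show ?thesis unfolding root_le_def using c(1) d(1)
    by (intro exI[of _ "\<lambda>\<delta>. c \<delta> + d \<delta>"]) auto
qed

lemma root_le_add: "\<gamma> \<in> \<Phi>p \<Longrightarrow> root_le \<Phi>p \<alpha> (\<alpha> + \<gamma>)"
proof -
  assume "\<gamma> \<in> \<Phi>p"
  moreover have "(\<Sum>\<delta>\<in>\<Phi>p. (if \<delta> = \<gamma> then 1 else 0) *\<^sub>R \<delta>) = (\<Sum>\<delta>\<in>\<Phi>p. if \<delta> = \<gamma> then \<gamma> else 0)"
    by (rule sum.cong) auto
  ultimately show ?thesis unfolding root_le_def using finite_roots(2)
    by (intro exI[of _ "\<lambda>\<delta>. if \<delta> = \<gamma> then 1 else 0"]) auto
qed

lemma root_le_inner_mono:
  assumes "root_le \<Phi>p \<alpha> \<beta>" "\<And>\<gamma>. \<gamma> \<in> \<Phi>p \<Longrightarrow> inner \<gamma> x \<ge> 0"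
  shows "inner \<alpha> x \<le> inner \<beta> x"
proof -
  obtain c where c: "\<forall>\<delta>\<in>\<Phi>p. c \<delta> \<ge> (0::real)" "\<beta> - \<alpha> = (\<Sum>\<delta>\<in>\<Phi>p. c \<delta> *\<^sub>R \<delta>)"
    using assms(1) unfolding root_le_def by blast
  have "inner (\<beta> - \<alpha>) x = (\<Sum>\<delta>\<in>\<Phi>p. c \<delta> * inner \<delta> x)" unfolding c(2) by (simp add: inner_sum_left)
  also have "\<dots> \<ge> 0" using c(1) assms(2) by (intro sum_nonneg mult_nonneg_nonneg) auto
  finally show ?thesis by (simp add: inner_diff_left)
qed

lemma root_le_antisym:
  assumes "root_le \<Phi>p \<alpha> \<beta>" "root_le \<Phi>p \<beta> \<alpha>"
  shows "\<alpha> = \<beta>"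
proof -
  have vp: "inner \<gamma> v \<ge> 0" if "\<gamma> \<in> \<Phi>p" for \<gamma> using pos_gt[OF that] by (simp add: inner_commute)
  have eq: "inner \<alpha> v = inner \<beta> v" using root_le_inner_mono[OF _ vp] assms by (meson antisym)
  obtain c where c: "\<forall>\<delta>\<in>\<Phi>p. c \<delta> \<ge> (0::real)" "\<beta> - \<alpha> = (\<Sum>\<delta>\<in>\<Phi>p. c \<delta> *\<^sub>R \<delta>)"
    using assms(1) unfolding root_le_def by blast
  have "(\<Sum>\<delta>\<in>\<Phi>p. c \<delta> * inner \<delta> v) = inner (\<beta> - \<alpha>) v" unfolding c(2) by (simp add: inner_sum_left)
  also have "\<dots> = 0" using eq by (simp add: inner_diff_left)
  finally have "\<forall>\<delta>\<in>\<Phi>p. c \<delta> * inner \<delta> v = 0"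
    using sum_nonneg_eq_0_iff[OF finite_roots(2), of "\<lambda>\<delta>. c \<delta> * inner \<delta> v"] c(1) vp by simp
  then have "c \<delta> = 0" if "\<delta> \<in> \<Phi>p" for \<delta> using that pos_gt[OF that] by (fastforce simp: inner_commute)
  then have "(\<Sum>\<delta>\<in>\<Phi>p. c \<delta> *\<^sub>R \<delta>) = 0" by (intro sum.neutral) auto
  then show ?thesis using c(2) by simp
qed

lemma inner_pos_if_simple_pos:
  assumes "\<And>\<sigma>. \<sigma> \<in> \<Delta> \<Longrightarrow> inner \<sigma> x > 0" and "\<alpha> \<in> \<Phi>p"
  shows "inner \<alpha> x > 0"
  using assms(2)
proof (induction rule: pos_induct)
  case (step \<alpha>)
  show ?case
  proof (cases "\<alpha> \<in> \<Delta>")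
    case False
    then obtain \<beta> \<gamma> where bc: "\<beta> \<in> \<Phi>p" "\<gamma> \<in> \<Phi>p" "\<alpha> = \<beta> + \<gamma>" using step.hyps by (auto simp: simple_roots_def)
    then show ?thesis using step.IH[of \<beta>] step.IH[of \<gamma>] pos_gt[of \<beta>] pos_gt[of \<gamma>]
      by (simp add: inner_add_left inner_add_right)
  qed (rule assms(1))
qed

lemma inner_orthogonal_spans:
  assumes orth: "\<And>\<sigma> \<tau>. \<sigma> \<in> P \<Longrightarrow> \<tau> \<in> Q \<Longrightarrow> inner \<sigma> \<tau> = 0" and x: "x \<in> span P" and y: "y \<in> span Q"
  shows "inner x (y::'a) = 0"
proof -
  have "orthogonal \<sigma> y" if s: "\<sigma> \<in> P" for \<sigma>
  proof (rule orthogonal_to_span[OF y])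
    show "orthogonal \<sigma> \<tau>" if "\<tau> \<in> Q" for \<tau> using orth[OF s that] by (simp add: orthogonal_def)
  qed
  then have "orthogonal y \<sigma>" if "\<sigma> \<in> P" for \<sigma> using that orthogonal_commute by blast
  then have "orthogonal y x" by (rule orthogonal_to_span[OF x])
  then show ?thesis by (simp add: orthogonal_def inner_commute)
qed

text \<open>An orthogonal splitting of the simple roots is inherited by all positive roots; the only
  danger is a sum of roots from both sides, excluded by \<open>no\<close>.\<close>

lemma root_in_orthogonal_span:
  assumes PQ: "P \<union> Q = \<Delta>" and orth: "\<And>\<sigma> \<tau>. \<sigma> \<in> P \<Longrightarrow> \<tau> \<in> Q \<Longrightarrow> inner \<sigma> \<tau> = 0" and "\<alpha> \<in> \<Phi>p"
  shows "\<alpha> \<in> span P \<or> \<alpha> \<in> span Q"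
  using assms(3)
proof (induction rule: pos_induct)
  case (step \<alpha>)
  have os1: "inner x y = 0" if "x \<in> span P" "y \<in> span Q" for x y
    using inner_orthogonal_spans[of P Q x y] orth that by blast
  have os2: "x = 0" if "x \<in> span P" "x \<in> span Q" for x
    using os1[OF that] by simp
  have no: False if b: "\<beta> \<in> \<Phi>p" "\<beta> \<in> span P" and c: "\<gamma> \<in> \<Phi>p" "\<gamma> \<in> span Q" and eq: "\<alpha> = \<beta> + \<gamma>" for \<beta> \<gamma>
  proof -
    have bc: "inner \<beta> \<gamma> = 0" using os1 b(2) c(2) by blast
    have nz: "\<beta> \<noteq> 0" "\<gamma> \<noteq> 0" using pos_nonzero b c by auto
    \<comment> \<open>Up to sign this reflected root is positive and of smaller height, so by
      induction it lies in one of the spans. That puts \<open>\<beta>\<close> or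
      \<open>\<gamma>\<close> into both spans and makes it 0.\<close>
    have "reflection \<gamma> \<alpha> = \<beta> - \<gamma>"
      using bc nz by (simp add: reflection_def eq inner_add_left scaleR_2)
    then have "\<beta> - \<gamma> \<in> \<Phi>" using refl_root[of \<gamma> \<alpha>] c(1) step.hyps pos_subset by auto
    then have "\<beta> - \<gamma> \<in> \<Phi>p \<or> \<gamma> - \<beta> \<in> \<Phi>p" using root_pos_or_neg by fastforce
    moreover have "inner v (\<beta> - \<gamma>) < inner v \<alpha>" "inner v (\<gamma> - \<beta>) < inner v \<alpha>"
      using pos_gt[OF b(1)] pos_gt[OF c(1)] by (auto simp: eq inner_add_right inner_diff_right)
    ultimately have "\<beta> - \<gamma> \<in> span P \<union> span Q \<or> \<gamma> - \<beta> \<in> span P \<union> span Q" using step.IH by blast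
    then have "\<beta> - \<gamma> \<in> span P \<union> span Q" using span_neg[of "\<gamma> - \<beta>"] by fastforce
    then have "\<gamma> \<in> span P \<or> \<beta> \<in> span Q"
      using span_diff[OF b(2), of "\<beta> - \<gamma>"] span_add[OF c(2), of "\<beta> - \<gamma>"] by auto
    then show False using os2[of \<beta>] os2[of \<gamma>] b(2) c(2) nz by blast
  qed
  show ?case
  proof (cases "\<alpha> \<in> \<Delta>")
    case True
    then show ?thesis using PQ span_base by blast
  next
    case False
    then obtain \<beta> \<gamma> where bc: "\<beta> \<in> \<Phi>p" "\<gamma> \<in> \<Phi>p" "\<alpha> = \<beta> + \<gamma>" using step.hyps by (auto simp: simple_roots_def)
    then have "\<beta> \<in> span P \<or> \<beta> \<in> span Q" "\<gamma> \<in> span P \<or> \<gamma> \<in> span Q"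
      using step.IH pos_gt by (auto simp: inner_add_right)
    then show ?thesis using no[of \<beta> \<gamma>] no[of \<gamma> \<beta>] bc span_add by (metis add.commute)
  qed
qed

end

section \<open>Existence of the highest root in the irreducible case\<close>

locale irreducible_positive_roots = positive_roots +
  assumes irreducible: "irreducible_root_system \<Phi>"
begin

text \<open>This is connectedness of the Dynkin diagram: a disconnected one would split
  \<open>\<Phi>\<close> itself along the two orthogonal spans.\<close>

lemma simple_connected:
  assumes "P \<subseteq> \<Delta>" "P \<noteq> {}" "P \<noteq> \<Delta>"
  shows "\<exists>\<sigma>\<in>P. \<exists>\<tau>\<in>\<Delta> - P. inner \<sigma> \<tau> \<noteq> 0"
proof (rule ccontr)
  assume no: "\<not> ?thesis"
  define Q where "Q = \<Delta> - P"
  have orth: "inner \<sigma> \<tau> = 0" if "\<sigma> \<in> P" "\<tau> \<in> Q" for \<sigma> \<tau> using no that by (auto simp: Q_def)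
  have PQ: "P \<union> Q = \<Delta>" using assms by (auto simp: Q_def)
  have os1: "inner x y = 0" if "x \<in> span P" "y \<in> span Q" for x y
    using inner_orthogonal_spans[of P Q x y] orth that by blast
  have os2: "x = 0" if "x \<in> span P" "x \<in> span Q" for x
    using os1[OF that] by simp
  define \<Phi>1 where "\<Phi>1 = \<Phi> \<inter> span P"
  define \<Phi>2 where "\<Phi>2 = \<Phi> \<inter> span Q"
  have "P \<subseteq> \<Phi>1" "Q \<subseteq> \<Phi>2" using PQ simple_subset pos_subset by (auto simp: \<Phi>1_def \<Phi>2_def span_base)
  then have ne: "\<Phi>1 \<noteq> {}" "\<Phi>2 \<noteq> {}" using assms by (auto simp: Q_def)
  have "\<alpha> \<in> span P \<union> span Q" if "\<alpha> \<in> \<Phi>" for \<alpha>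
    using root_pos_or_neg[OF that] root_in_orthogonal_span[OF PQ orth] span_neg[of "- \<alpha>"] by fastforce
  then have un: "\<Phi>1 \<union> \<Phi>2 = \<Phi>" by (auto simp: \<Phi>1_def \<Phi>2_def)
  have "x = 0" if "x \<in> \<Phi>1" "x \<in> \<Phi>2" for x using os2[of x] that by (simp add: \<Phi>1_def \<Phi>2_def)
  then have "\<Phi>1 \<inter> \<Phi>2 = {}" using zero_not_root \<Phi>1_def by auto
  moreover have "\<forall>\<alpha>\<in>\<Phi>1. \<forall>\<beta>\<in>\<Phi>2. inner \<alpha> \<beta> = 0" using os1 by (auto simp: \<Phi>1_def \<Phi>2_def)
  ultimately show False using irreducible ne un unfolding irreducible_root_system_def by blast
qed

text \<open>A local form of maximality, easy to obtain by maximizing the height; its uniqueness is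
  what makes it the highest root.\<close>

definition "maximal_root \<alpha> \<longleftrightarrow> \<alpha> \<in> \<Phi>p \<and> (\<forall>\<gamma>\<in>\<Phi>p. \<alpha> + \<gamma> \<notin> \<Phi>p)"

lemma maximal_root_above:
  assumes "\<beta> \<in> \<Phi>p"
  shows "\<exists>\<alpha>. maximal_root \<alpha> \<and> root_le \<Phi>p \<beta> \<alpha>"
proof -
  define U where "U = {\<alpha>\<in>\<Phi>p. root_le \<Phi>p \<beta> \<alpha>}"
  have "finite U" "U \<noteq> {}" using finite_roots(2) assms root_le_refl by (auto simp: U_def)
  then obtain \<alpha> where "\<alpha> \<in> U" "Max (inner v ` U) = inner v \<alpha>"
    by (rule obtains_MAX[where f = "inner v"])
  then have a: "\<alpha> \<in> U" "\<And>\<gamma>. \<gamma> \<in> U \<Longrightarrow> inner v \<gamma> \<le> inner v \<alpha>"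
    using \<open>finite U\<close> by (simp_all flip: \<open>Max _ = _\<close>)
  have "\<alpha> + \<gamma> \<notin> \<Phi>p" if c: "\<gamma> \<in> \<Phi>p" for \<gamma>
  proof
    assume "\<alpha> + \<gamma> \<in> \<Phi>p"
    then have "\<alpha> + \<gamma> \<in> U" using a(1) root_le_trans[OF _ root_le_add[OF c]] by (auto simp: U_def)
    then show False using a(2) pos_gt[OF c] by (fastforce simp: inner_add_right)
  qed
  then show ?thesis using a(1) by (auto simp: U_def maximal_root_def)
qed

lemma maximal_root_inner: "maximal_root \<alpha> \<Longrightarrow> \<gamma> \<in> \<Phi>p \<Longrightarrow> inner \<alpha> \<gamma> \<ge> 0"
  using sum_pos_root[of \<alpha> \<gamma>] by (force simp: maximal_root_def)

text \<open>If the support were proper, connectedness would give a simple root \<open>\<rho>\<close>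
  outside it that is not orthogonal to it. All terms of \<open>inner \<alpha> \<rho>\<close> are
  then nonpositive and one is negative, so a root could be added to \<open>\<alpha>\<close>.\<close>

lemma maximal_root_full_support:
  assumes a: "maximal_root \<alpha>" and n: "\<alpha> = (\<Sum>\<sigma>\<in>\<Delta>. real (n \<sigma>) *\<^sub>R \<sigma>)" and "\<tau> \<in> \<Delta>"
  shows "n \<tau> > 0"
proof (rule ccontr)
  assume t: "\<not> n \<tau> > 0"
  define P where "P = {\<sigma>\<in>\<Delta>. n \<sigma> > 0}"
  have "P \<noteq> {}"
  proof
    assume "P = {}"
    then have "\<alpha> = 0" unfolding n by (intro sum.neutral) (auto simp: P_def)
    then show False using a pos_nonzero by (auto simp: maximal_root_def)
  qed
  moreover have "\<tau> \<notin> P" "P \<subseteq> \<Delta>" using t by (auto simp: P_def)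
  moreover from this have "P \<noteq> \<Delta>" using assms(3) by blast
  ultimately obtain \<sigma> \<rho> where s: "\<sigma> \<in> P" and r: "\<rho> \<in> \<Delta> - P" and ne: "inner \<sigma> \<rho> \<noteq> 0"
    using simple_connected[of P] by blast
  have le: "real (n \<sigma>') * inner \<sigma>' \<rho> \<le> 0" if "\<sigma>' \<in> \<Delta>" for \<sigma>'
    using simple_obtuse[OF that, of \<rho>] r by (cases "\<sigma>' = \<rho>") (auto simp: P_def mult_nonneg_nonpos)
  have "inner \<sigma> \<rho> < 0" using simple_obtuse[of \<sigma> \<rho>] s r ne by (force simp: P_def)
  then have "real (n \<sigma>) * inner \<sigma> \<rho> < 0" using s by (simp add: P_def mult_pos_neg)
  then have "(\<Sum>\<sigma>\<in>\<Delta>. real (n \<sigma>) * inner \<sigma> \<rho>) < (\<Sum>\<sigma>\<in>\<Delta>. 0)"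
    using le s finite_simple by (intro sum_strict_mono_ex1) (auto simp: P_def)
  then have "inner \<alpha> \<rho> < 0" unfolding n inner_sum_left by simp
  then show False using maximal_root_inner[OF a, of \<rho>] r simple_subset by force
qed

text \<open>\<open>\<alpha>\<close> is nonnegative on all simple roots and positive on one of them,
  and \<open>\<beta>\<close> involves every simple root, so
  \<open>inner \<alpha> \<beta> > 0\<close>. If the two differed, their difference would be a root
  that can be added to one of them.\<close>

lemma maximal_root_unique:
  assumes a: "maximal_root \<alpha>" and b: "maximal_root \<beta>"
  shows "\<alpha> = \<beta>"
proof -
  have P: "\<alpha> \<in> \<Phi>p" "\<beta> \<in> \<Phi>p" using a b by (auto simp: maximal_root_def)
  obtain n :: "'a \<Rightarrow> nat" where n: "\<beta> = (\<Sum>\<sigma>\<in>\<Delta>. real (n \<sigma>) *\<^sub>R \<sigma>)" using pos_root_nat_coords[OF P(2)] by blast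
  have "\<exists>\<sigma>\<in>\<Delta>. inner \<alpha> \<sigma> \<noteq> 0"
  proof (rule ccontr)
    assume "\<not> ?thesis"
    then have "orthogonal \<alpha> \<alpha>"
      using span_simple by (intro orthogonal_to_span[of \<alpha> \<Delta>]) (auto simp: orthogonal_def)
    then show False using pos_nonzero[OF P(1)] by (simp add: orthogonal_def)
  qed
  then obtain \<sigma> where s: "\<sigma> \<in> \<Delta>" "inner \<alpha> \<sigma> \<noteq> 0" by blast
  have ge: "inner \<alpha> \<sigma>' \<ge> 0" if "\<sigma>' \<in> \<Delta>" for \<sigma>' using maximal_root_inner[OF a] that simple_subset by blast
  have "(\<Sum>\<sigma>\<in>\<Delta>. 0) < (\<Sum>\<sigma>\<in>\<Delta>. real (n \<sigma>) * inner \<alpha> \<sigma>)"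
  proof (rule sum_strict_mono_ex1[OF finite_simple])
    show "\<exists>\<sigma>\<in>\<Delta>. 0 < real (n \<sigma>) * inner \<alpha> \<sigma>"
      using s ge[OF s(1)] maximal_root_full_support[OF b n s(1)] by (intro bexI[of _ \<sigma>]) auto
  qed (use ge in auto)
  then have "inner \<alpha> \<beta> > 0" by (subst n) (simp add: inner_sum_right)
  moreover have "\<beta> - \<alpha> \<notin> \<Phi>p" "\<alpha> - \<beta> \<notin> \<Phi>p" using a b by (fastforce simp: maximal_root_def)+
  ultimately show ?thesis using diff_pos_root[OF P] by blast
qed

lemma highest_root: "highest_root \<Phi>p \<in> \<Phi>p" "\<beta> \<in> \<Phi>p \<Longrightarrow> root_le \<Phi>p \<beta> (highest_root \<Phi>p)"
proof -
  have "\<Phi> \<noteq> {}"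
  proof
    assume "\<Phi> = {}"
    then have "(UNIV :: 'a set) = {0}" using span_roots by simp
    moreover obtain b :: 'a where "b \<in> Basis" using nonempty_Basis by blast
    ultimately show False using nonzero_Basis by blast
  qed
  then obtain \<beta>0 where "\<beta>0 \<in> \<Phi>p" using root_pos_or_neg by blast
  then obtain \<theta> where t: "maximal_root \<theta>" using maximal_root_above by blast
  have le: "root_le \<Phi>p \<beta> \<theta>" if "\<beta> \<in> \<Phi>p" for \<beta>
    using maximal_root_above[OF that] maximal_root_unique[OF t] by blast
  have tP: "\<theta> \<in> \<Phi>p" using t by (simp add: maximal_root_def)
  have "highest_root \<Phi>p = \<theta>" unfolding highest_root_def
    using tP le root_le_antisym by (intro the_equality) blast+
  then show "highest_root \<Phi>p \<in> \<Phi>p" "\<beta> \<in> \<Phi>p \<Longrightarrow> root_le \<Phi>p \<beta> (highest_root \<Phi>p)" using tP le by auto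
qed

text \<open>The alcove is dominant, so there every positive root is bounded by the highest
  one.\<close>

lemma fundamental_alcove_less_1:
  assumes "x \<in> fundamental_alcove \<Phi>p" "\<alpha> \<in> \<Phi>p"
  shows "inner \<alpha> x < 1"
proof -
  have "inner \<gamma> x > 0" if "\<gamma> \<in> \<Phi>p" for \<gamma>
    using inner_pos_if_simple_pos[OF _ that] assms(1) by (auto simp: fundamental_alcove_def)
  then have "inner \<alpha> x \<le> inner (highest_root \<Phi>p) x"
    using root_le_inner_mono[OF highest_root(2)[OF assms(2)]] by (auto simp: less_imp_le)
  then show ?thesis using assms(1) by (simp add: fundamental_alcove_def)
qed

text \<open>With an empty alcove, the inclusions in \<open>separates\<close> that concern it would
  hold vacuously.\<close>

lemma fundamental_alcove_nonempty: "fundamental_alcove \<Phi>p \<noteq> {}"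
proof -
  let ?t = "inner v (highest_root \<Phi>p)"
  have t: "?t > 0" using pos_gt highest_root(1) by blast
  have "(1 / (2 * ?t)) *\<^sub>R v \<in> fundamental_alcove \<Phi>p"
    using t pos_gt simple_subset by (auto simp: fundamental_alcove_def inner_commute)
  then show ?thesis by blast
qed

lemma separates_alcove_iff:
  assumes g: "geometric_chain \<Phi>p m I" and m: "m \<ge> 1" and a: "\<alpha> \<in> \<Phi>p"
  shows "separates (hyp \<alpha> (real m)) (cell \<Phi>p m I) (fundamental_alcove \<Phi>p) \<longleftrightarrow> \<alpha> \<in> I m"
proof -
  obtain x where x: "x \<in> cell \<Phi>p m I" using cell_nonempty[OF g] by blast
  obtain y where y: "y \<in> fundamental_alcove \<Phi>p" using fundamental_alcove_nonempty by blast
  have A: "inner \<alpha> z < real m" if "z \<in> fundamental_alcove \<Phi>p" for z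
    using fundamental_alcove_less_1[OF that a] m by linarith
  have C: "\<alpha> \<in> I m \<longleftrightarrow> inner \<alpha> z > real m" if "z \<in> cell \<Phi>p m I" for z
    using cell_mem_iff[OF that a] by simp
  show ?thesis unfolding separates_hyp_iff[OF pos_nonzero[OF a]]
  proof
    assume "cell \<Phi>p m I \<subseteq> {x. inner \<alpha> x < real m} \<and> fundamental_alcove \<Phi>p \<subseteq> {x. real m < inner \<alpha> x} \<or>
      cell \<Phi>p m I \<subseteq> {x. real m < inner \<alpha> x} \<and> fundamental_alcove \<Phi>p \<subseteq> {x. inner \<alpha> x < real m}"
    then have "inner \<alpha> x > real m" using A[OF y] x y by fastforce
    then show "\<alpha> \<in> I m" using C[OF x] by simp
  qed (use A C in auto)
qed

lemma wall_iff:
  assumes g: "geometric_chain \<Phi>p m I" and m: "m \<ge> 1" and a: "\<alpha> \<in> \<Phi>"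
  shows "is_wall \<Phi> m (cell \<Phi>p m I) (hyp \<alpha> (real m)) \<and>
      separates (hyp \<alpha> (real m)) (cell \<Phi>p m I) (fundamental_alcove \<Phi>p) \<longleftrightarrow> indecomposable \<Phi>p m I \<alpha>"
    and "is_wall \<Phi> m (cell \<Phi>p m I) (hyp \<alpha> (real m)) \<and>
      \<not> separates (hyp \<alpha> (real m)) (cell \<Phi>p m I) (fundamental_alcove \<Phi>p) \<longleftrightarrow> \<alpha> \<in> flippable \<Phi>p m I"
proof -
  note gd = geometric_chainD[OF g]
  have wall: "is_wall \<Phi> m (cell \<Phi>p m I) (hyp \<alpha> (real m)) \<longleftrightarrow>
      aff_dim (hyp \<alpha> (real m) \<inter> closure (cell \<Phi>p m I)) = int DIM('a) - 1"
    using a by (auto simp: is_wall_def arrangement_def)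
  \<comment> \<open>For a negative root, the hyperplane at the positive level \<open>m\<close>
    misses the closed dominant chamber.\<close>
  have neg: "\<not> is_wall \<Phi> m (cell \<Phi>p m I) (hyp \<alpha> (real m))" if n: "\<alpha> \<notin> \<Phi>p"
  proof -
    have "- \<alpha> \<in> \<Phi>p" using root_pos_or_neg[OF a] n by blast
    then have "inner (- \<alpha>) y \<ge> real 0" if "y \<in> closure (cell \<Phi>p m I)" for y
      using closed_sides_closure(1)[OF that, of "- \<alpha>" 0] gd(1) by simp
    then have "hyp \<alpha> (real m) \<inter> closure (cell \<Phi>p m I) = {}" using m by (fastforce simp: hyp_def)
    then show ?thesis unfolding wall by simp
  qed
  have sub: "indecomposable \<Phi>p m I \<alpha> \<Longrightarrow> \<alpha> \<in> \<Phi>p" "\<alpha> \<in> flippable \<Phi>p m I \<Longrightarrow> \<alpha> \<in> \<Phi>p"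
    using gd(2) by (auto simp: indecomposable_def flippable_def)
  have top: "indecomposable \<Phi>p m I \<alpha> \<Longrightarrow> \<alpha> \<in> I m" "\<alpha> \<in> flippable \<Phi>p m I \<Longrightarrow> \<alpha> \<notin> I m"
    by (auto simp: indecomposable_def flippable_def)
  show "is_wall \<Phi> m (cell \<Phi>p m I) (hyp \<alpha> (real m)) \<and>
      separates (hyp \<alpha> (real m)) (cell \<Phi>p m I) (fundamental_alcove \<Phi>p) \<longleftrightarrow> indecomposable \<Phi>p m I \<alpha>"
    using neg sub(1) top(1) separates_alcove_iff[OF g m] facet_iff_indecomposable[OF g m, of \<alpha>] wall by blast
  show "is_wall \<Phi> m (cell \<Phi>p m I) (hyp \<alpha> (real m)) \<and>
      \<not> separates (hyp \<alpha> (real m)) (cell \<Phi>p m I) (fundamental_alcove \<Phi>p) \<longleftrightarrow> \<alpha> \<in> flippable \<Phi>p m I"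
    using neg sub(2) top(2) separates_alcove_iff[OF g m] facet_iff_flippable[OF g m, of \<alpha>] wall by blast
qed

end

section \<open>Enumeration\<close>

lemma sum_binomial_reverse:
  fixes y :: "'b::comm_semiring_1"
  assumes "i \<le> n"
  shows "(\<Sum>k\<le>n. of_nat ((n - i) choose (n - k)) * y ^ (n - k)) = (y + 1) ^ (n - i)"
proof -
  have "(\<Sum>k\<le>n. of_nat ((n - i) choose (n - k)) * y ^ (n - k)) = (\<Sum>k\<le>n. of_nat ((n - i) choose k) * y ^ k)"
    by (rule sum.reindex_bij_witness[where i = "\<lambda>k. n - k" and j = "\<lambda>k. n - k"]) auto
  also have "\<dots> = (\<Sum>k\<le>n - i. of_nat ((n - i) choose k) * y ^ k)"
    by (rule sum.mono_neutral_right) (auto simp: binomial_eq_0)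
  also have "\<dots> = (y + 1) ^ (n - i)" by (simp add: binomial_ring)
  finally show ?thesis .
qed

text \<open>Expanding powers of \<open>x = (x - 1) + 1\<close> exhibits a solution of the defining
  identity. It is the only one, because a polynomial in \<open>x - 1\<close> determines its
  coefficients and the values beyond the rank are fixed to 0; this justifies the
  \<open>THE\<close>.\<close>

lemma f_plus_eq:
  fixes \<Phi> \<Phi>p :: "'a::euclidean_space set"
  assumes k: "k \<le> DIM('a)"
  shows "f_plus \<Phi> \<Phi>p m k = int (\<Sum>i\<le>DIM('a). h_plus \<Phi> \<Phi>p m i * ((DIM('a) - i) choose (DIM('a) - k)))"
proof -
  let ?n = "DIM('a)" and ?h = "h_plus \<Phi> \<Phi>p m"
  define g where "g k = (if k \<le> ?n then int (\<Sum>i\<le>?n. ?h i * ((?n - i) choose (?n - k))) else 0)" for k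
  have eq: "(\<Sum>i\<le>?n. of_int (g i) * (x - 1) ^ (?n - i)) = (\<Sum>i\<le>?n. of_nat (?h i) * x ^ (?n - i))" for x :: real
  proof -
    have "(\<Sum>k\<le>?n. of_int (g k) * (x - 1) ^ (?n - k)) =
        (\<Sum>k\<le>?n. \<Sum>i\<le>?n. real (?h i) * (real ((?n - i) choose (?n - k)) * (x - 1) ^ (?n - k)))"
      by (intro sum.cong refl) (simp add: g_def sum_distrib_right mult.assoc)
    also have "\<dots> = (\<Sum>i\<le>?n. real (?h i) * (\<Sum>k\<le>?n. real ((?n - i) choose (?n - k)) * (x - 1) ^ (?n - k)))"
      by (subst sum.swap) (simp add: sum_distrib_left)
    also have "\<dots> = (\<Sum>i\<le>?n. real (?h i) * x ^ (?n - i))"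
      by (intro sum.cong refl) (simp add: sum_binomial_reverse[where y = "x - 1"])
    finally show ?thesis .
  qed
  have "f_plus \<Phi> \<Phi>p m = g"
    unfolding f_plus_def
  proof (rule the_equality)
    fix f assume f: "(\<forall>i>?n. f i = 0) \<and>
        (\<forall>x::real. (\<Sum>i\<le>?n. of_int (f i) * (x - 1) ^ (?n - i)) = (\<Sum>i\<le>?n. of_nat (?h i) * x ^ (?n - i)))"
    have z: "(\<Sum>i\<le>?n. real_of_int (f (?n - i) - g (?n - i)) * y ^ i) = 0" for y :: real
    proof -
      have "(\<Sum>i\<le>?n. real_of_int (f (?n - i) - g (?n - i)) * y ^ i) = (\<Sum>i\<le>?n. real_of_int (f i - g i) * y ^ (?n - i))"
        by (rule sum.reindex_bij_witness[where i = "\<lambda>k. ?n - k" and j = "\<lambda>k. ?n - k"]) auto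
      also have "\<dots> = (\<Sum>i\<le>?n. of_int (f i) * ((y + 1) - 1) ^ (?n - i)) - (\<Sum>i\<le>?n. of_int (g i) * ((y + 1) - 1) ^ (?n - i))"
        by (simp add: left_diff_distrib sum_subtractf)
      also have "(\<Sum>i\<le>?n. of_int (f i) * ((y + 1) - 1) ^ (?n - i)) = (\<Sum>i\<le>?n. of_nat (?h i) * (y + 1) ^ (?n - i))"
        using f by blast
      also note eq[of "y + 1"]
      finally show ?thesis by simp
    qed
    have "f i = g i" for i
    proof (cases "i \<le> ?n")
      case True
      then have "real_of_int (f (?n - (?n - i)) - g (?n - (?n - i))) = 0"
        by (intro zero_polynom_imp_zero_coeffs[OF z]) simp
      then show ?thesis using True by simp
    qed (use f in \<open>simp add: g_def\<close>)
    then show "f = g" by auto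
  qed (use eq in \<open>auto simp: g_def\<close>)
  then show ?thesis using k by (simp add: g_def)
qed

context positive_roots
begin

text \<open>Chains are functions on all of \<open>nat\<close>, but the constant tail makes them
  determined by the values at indices up to \<open>m\<close>.\<close>

lemma finite_geometric_chains: "finite {I. geometric_chain \<Phi>p m I}"
proof -
  let ?f = "\<lambda>I :: nat \<Rightarrow> 'a set. map I [0..<Suc m]"
  have "?f ` {I. geometric_chain \<Phi>p m I} \<subseteq> {xs. set xs \<subseteq> Pow \<Phi>p \<and> length xs = Suc m}"
    using geometric_chainD(2) by fastforce
  moreover have "finite {xs. set xs \<subseteq> Pow \<Phi>p \<and> length xs = Suc m}"
    using finite_roots(2) by (intro finite_lists_length_eq) simp
  ultimately have "finite (?f ` {I. geometric_chain \<Phi>p m I})" by (rule finite_subset)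
  moreover have "inj_on ?f {I. geometric_chain \<Phi>p m I}"
  proof (rule inj_onI, clarify)
    fix I I' assume g: "geometric_chain \<Phi>p m I" "geometric_chain \<Phi>p m I'" and eq: "?f I = ?f I'"
    have le: "I i = I' i" if "i \<le> m" for i
    proof -
      have "i \<in> set [0..<Suc m]" using that by auto
      then show ?thesis using eq unfolding map_eq_conv by blast
    qed
    show "I = I'"
    proof
      fix i show "I i = I' i"
        using le[of i] le[of m] geometric_chainD(4)[OF g(1), of i] geometric_chainD(4)[OF g(2), of i]
        by (cases "i \<le> m") auto
    qed
  qed
  ultimately show ?thesis by (rule finite_imageD)
qed

lemma bounded_if_simple_bounded:
  assumes "\<And>x \<sigma>. x \<in> R \<Longrightarrow> \<sigma> \<in> \<Delta> \<Longrightarrow> \<bar>inner \<sigma> x\<bar> \<le> B"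
  shows "bounded R"
proof -
  have "\<exists>u. (\<Sum>\<sigma>\<in>\<Delta>. u \<sigma> *\<^sub>R \<sigma>) = b" for b
  proof -
    have "b \<in> range (\<lambda>u. \<Sum>\<sigma>\<in>\<Delta>. u \<sigma> *\<^sub>R \<sigma>)" using span_simple span_finite[OF finite_simple] by simp
    then show ?thesis by auto
  qed
  then have "\<forall>b. \<exists>u. (\<Sum>\<sigma>\<in>\<Delta>. u \<sigma> *\<^sub>R \<sigma>) = b" by blast
  from choice[OF this] obtain u where u: "\<And>b. (\<Sum>\<sigma>\<in>\<Delta>. u b \<sigma> *\<^sub>R \<sigma>) = b" by blast
  have "norm x \<le> (\<Sum>b\<in>Basis. \<Sum>\<sigma>\<in>\<Delta>. \<bar>u b \<sigma>\<bar> * B)" if x: "x \<in> R" for x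
  proof -
    have "\<bar>inner x b\<bar> \<le> (\<Sum>\<sigma>\<in>\<Delta>. \<bar>u b \<sigma>\<bar> * B)" for b
    proof -
      have "inner x b = inner x (\<Sum>\<sigma>\<in>\<Delta>. u b \<sigma> *\<^sub>R \<sigma>)" by (simp add: u)
      also have "\<dots> = (\<Sum>\<sigma>\<in>\<Delta>. u b \<sigma> * inner \<sigma> x)" by (simp add: inner_sum_right inner_commute)
      finally have "\<bar>inner x b\<bar> \<le> (\<Sum>\<sigma>\<in>\<Delta>. \<bar>u b \<sigma> * inner \<sigma> x\<bar>)" by simp
      also have "\<dots> \<le> (\<Sum>\<sigma>\<in>\<Delta>. \<bar>u b \<sigma>\<bar> * B)"
        unfolding abs_mult by (intro sum_mono mult_left_mono assms x) auto
      finally show ?thesis .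
    qed
    then show ?thesis using norm_le_l1[of x] by (meson order_trans sum_mono)
  qed
  then show ?thesis unfolding bounded_iff by blast
qed

text \<open>If a simple root \<open>\<sigma>\<close> lies in \<open>I m\<close>, the cell recedes in the direction dual to \<open>\<sigma>\<close>.\<close>

lemma bounded_cell_iff:
  assumes g: "geometric_chain \<Phi>p m I"
  shows "bounded (cell \<Phi>p m I) \<longleftrightarrow> \<Delta> \<inter> I m = {}"
proof
  note gd = geometric_chainD[OF g]
  assume "\<Delta> \<inter> I m = {}"
  show "bounded (cell \<Phi>p m I)"
  proof (rule bounded_if_simple_bounded)
    fix x \<sigma> assume x: "x \<in> cell \<Phi>p m I" and s: "\<sigma> \<in> \<Delta>"
    have sP: "\<sigma> \<in> \<Phi>p" using s simple_subset by blast
    have "inner \<sigma> x > 0" using cell_mem_iff[OF x sP, of 0] gd(1) sP by simp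
    moreover have "\<not> inner \<sigma> x > real m"
      using cell_mem_iff[OF x sP, of m] s \<open>\<Delta> \<inter> I m = {}\<close> by auto
    ultimately show "\<bar>inner \<sigma> x\<bar> \<le> real m" by linarith
  qed
next
  note gd = geometric_chainD[OF g]
  assume bd: "bounded (cell \<Phi>p m I)"
  show "\<Delta> \<inter> I m = {}"
  proof (rule ccontr)
    assume "\<Delta> \<inter> I m \<noteq> {}"
    then obtain \<sigma> where s: "\<sigma> \<in> \<Delta>" "\<sigma> \<in> I m" by blast
    \<comment> \<open>\<open>\<omega>\<close> is the component of \<open>\<sigma>\<close> orthogonal
      to the other simple roots, hence a positive multiple of the fundamental coweight of
      \<open>\<sigma>\<close>.\<close>
    obtain y \<omega> where yw: "y \<in> span (\<Delta> - {\<sigma>})" "\<And>w. w \<in> span (\<Delta> - {\<sigma>}) \<Longrightarrow> orthogonal \<omega> w" "\<sigma> = y + \<omega>"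
      using orthogonal_subspace_decomp_exists[of "\<Delta> - {\<sigma>}" \<sigma>] by blast
    have "\<sigma> \<notin> span (\<Delta> - {\<sigma>})" using independent_simple s(1) unfolding dependent_def by blast
    then have w0: "\<omega> \<noteq> 0" using yw by auto
    have ws: "inner \<tau> \<omega> = (if \<tau> = \<sigma> then inner \<omega> \<omega> else 0)" if "\<tau> \<in> \<Delta>" for \<tau>
    proof (cases "\<tau> = \<sigma>")
      case True
      have "inner y \<omega> = 0" using yw(2)[OF yw(1)] by (simp add: orthogonal_def inner_commute)
      then show ?thesis using True yw(3) by (simp add: inner_add_left)
    next
      case False
      then show ?thesis using yw(2)[of \<tau>] that by (simp add: orthogonal_def inner_commute span_base)
    qed
    obtain x where x: "x \<in> cell \<Phi>p m I" using cell_nonempty[OF g] by blast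
    \<comment> \<open>A positive root grows along \<open>\<omega>\<close> only if
      \<open>\<sigma>\<close> occurs in it. It is then above \<open>\<sigma>\<close>, lies in the
      filter \<open>I m\<close>, and has no upper bound in the cell.\<close>
    have root: "inner \<alpha> \<omega> = 0 \<or> inner \<alpha> \<omega> > 0 \<and> \<alpha> \<in> I m" if a: "\<alpha> \<in> \<Phi>p" for \<alpha>
    proof -
      obtain n :: "'a \<Rightarrow> nat" where n: "\<alpha> = (\<Sum>\<tau>\<in>\<Delta>. real (n \<tau>) *\<^sub>R \<tau>)" using pos_root_nat_coords[OF a] by blast
      have "inner \<alpha> \<omega> = (\<Sum>\<tau>\<in>\<Delta>. real (n \<tau>) * inner \<tau> \<omega>)" by (subst n) (simp add: inner_sum_left)
      also have "\<dots> = (\<Sum>\<tau>\<in>\<Delta>. if \<tau> = \<sigma> then real (n \<sigma>) * inner \<omega> \<omega> else 0)"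
        by (intro sum.cong refl) (simp add: ws)
      also have "\<dots> = real (n \<sigma>) * inner \<omega> \<omega>" using s(1) finite_simple by simp
      finally have ip: "inner \<alpha> \<omega> = real (n \<sigma>) * inner \<omega> \<omega>" .
      show ?thesis
      proof (cases "n \<sigma> = 0")
        case False
        have "\<alpha> = real (n \<sigma>) *\<^sub>R \<sigma> + (\<Sum>\<tau>\<in>\<Delta>-{\<sigma>}. real (n \<tau>) *\<^sub>R \<tau>)"
          by (subst n) (rule sum.remove[OF finite_simple s(1)])
        also have "\<dots> = \<sigma> + (real (n \<sigma> - 1) *\<^sub>R \<sigma> + (\<Sum>\<tau>\<in>\<Delta>-{\<sigma>}. real (n \<tau>) *\<^sub>R \<tau>))"
          using False by (simp add: of_nat_diff scaleR_diff_left)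
        also have "real (n \<sigma> - 1) *\<^sub>R \<sigma> + (\<Sum>\<tau>\<in>\<Delta>-{\<sigma>}. real (n \<tau>) *\<^sub>R \<tau>) =
            (\<Sum>\<tau>\<in>\<Delta>. real ((n(\<sigma> := n \<sigma> - 1)) \<tau>) *\<^sub>R \<tau>)"
          by (subst sum.remove[OF finite_simple s(1)]) (auto intro!: sum.cong)
        finally have "\<alpha> = \<sigma> + (\<Sum>\<tau>\<in>\<Delta>. real ((n(\<sigma> := n \<sigma> - 1)) \<tau>) *\<^sub>R \<tau>)" .
        then have "\<alpha> \<in> I m"
          using gd(5)[of _ m _ 0] gd(1) by (intro up_closed_add[OF gd(2)[of m] _ s(2) a]) auto
        then show ?thesis using ip False w0 by simp
      qed (simp add: ip)
    qed
    have ray: "x + t *\<^sub>R \<omega> \<in> cell \<Phi>p m I" if t: "t \<ge> 0" for t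
      unfolding cell_def
    proof (intro CollectI ballI allI impI conjI)
      fix \<alpha> i assume a: "\<alpha> \<in> \<Phi>p" "i \<le> m"
      have ge: "inner \<alpha> (x + t *\<^sub>R \<omega>) \<ge> inner \<alpha> x" using root[OF a(1)] t by (auto simp: inner_add_right)
      {
        assume "\<alpha> \<in> I i"
        then show "real i < inner \<alpha> (x + t *\<^sub>R \<omega>)" using cell_mem_iff[OF x a] ge by simp
      next
        assume n: "\<alpha> \<notin> I i"
        then have "\<alpha> \<notin> I m" using gd(3)[OF a(2)] by blast
        then have "inner \<alpha> \<omega> = 0" using root[OF a(1)] by blast
        then show "inner \<alpha> (x + t *\<^sub>R \<omega>) < real i"
          using x a n by (simp add: cell_def inner_add_right)
      }
    qed
    obtain B where B: "\<And>z. z \<in> cell \<Phi>p m I \<Longrightarrow> norm z \<le> B" using bd unfolding bounded_iff by blast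
    have nw: "norm \<omega> > 0" using w0 by simp
    \<comment> \<open>Two points of the cell are at distance at most
      \<open>2 * \<bar>B\<bar>\<close>; this \<open>t\<close> moves \<open>x\<close> one unit
      further than that.\<close>
    define t where "t = (2 * \<bar>B\<bar> + 1) / norm \<omega>"
    have t: "t \<ge> 0" "norm (t *\<^sub>R \<omega>) = 2 * \<bar>B\<bar> + 1" using nw by (auto simp: t_def)
    have "norm (t *\<^sub>R \<omega>) \<le> norm (x + t *\<^sub>R \<omega>) + norm x" using norm_triangle_ineq4[of "x + t *\<^sub>R \<omega>" x] by simp
    also have "\<dots> \<le> 2 * \<bar>B\<bar>" using B[OF ray[OF t(1)]] B[OF x] by linarith
    finally show False using t(2) by simp
  qed
qed

lemma inj_on_hyp: "m \<ge> 1 \<Longrightarrow> inj_on (\<lambda>\<alpha>. hyp \<alpha> (real m)) \<Phi>p"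
proof (rule inj_onI)
  fix \<alpha> \<beta> assume m: "m \<ge> 1" and a: "\<alpha> \<in> \<Phi>p" and b: "\<beta> \<in> \<Phi>p" and eq: "hyp \<alpha> (real m) = hyp \<beta> (real m)"
  have "{x. inner \<alpha> x = real m} \<subseteq> {x. inner \<beta> x = real m}" using eq by (simp add: hyp_def)
  then obtain l where "\<beta> = l *\<^sub>R \<alpha>" using hyperplane_subset_parallel[OF pos_nonzero[OF a]] by blast
  then have "\<beta> = \<alpha>" by (rule pos_parallel[OF a b])
  then show "\<alpha> = \<beta>" by (rule sym)
qed

text \<open>A simple root in \<open>I m\<close> is automatically indecomposable. Hence requiring
  \<open>T\<close> to contain the simple indecomposable roots says that removing \<open>T\<close>
  leaves no simple root in \<open>I m\<close>, which is boundedness. Keeping \<open>T\<close> in the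
  pair makes adding and removing it mutually inverse.\<close>

lemma bij_betw_raise:
  assumes m: "m \<ge> 1"
  shows "bij_betw (\<lambda>(I, T). (change_top m I (I m \<union> T), T))
    {(I, T). geometric_chain \<Phi>p m I \<and> \<Delta> \<inter> I m = {} \<and> T \<subseteq> flippable \<Phi>p m I \<and> card T = n}
    {(I, T). geometric_chain \<Phi>p m I \<and> T \<subseteq> {\<alpha>. indecomposable \<Phi>p m I \<alpha>} \<and> card T = n \<and>
        {\<alpha>\<in>\<Delta>. indecomposable \<Phi>p m I \<alpha>} \<subseteq> T}" (is "bij_betw ?up ?A ?B")
proof (rule bij_betw_byWitness[where f' = "\<lambda>(I, T). (change_top m I (I m - T), T)"])
  have chg: "change_top m (change_top m I X) Y = change_top m I Y" for I :: "nat \<Rightarrow> 'a set" and X Y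
    by (rule ext) (simp add: change_top_def)
  have id: "change_top m I (I m) = I" if "geometric_chain \<Phi>p m I" for I
    using geometric_chainD(4)[OF that] by (auto simp: change_top_def not_less le_less fun_eq_iff)
  have simple_ind: "indecomposable \<Phi>p m I \<sigma> \<longleftrightarrow> \<sigma> \<in> I m" if "geometric_chain \<Phi>p m I" "\<sigma> \<in> \<Delta>" for I \<sigma>
    using geometric_chainD(2)[OF that(1)] that(2) unfolding indecomposable_def simple_roots_def by blast
  show "\<forall>a\<in>?A. (\<lambda>(I, T). (change_top m I (I m - T), T)) (?up a) = a"
  proof
    fix a assume "a \<in> ?A"
    then obtain I T where a: "a = (I, T)" and g: "geometric_chain \<Phi>p m I" and T: "T \<subseteq> flippable \<Phi>p m I" by blast
    have "I m \<union> T - T = I m" using T by (auto simp: flippable_def)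
    then show "(\<lambda>(I, T). (change_top m I (I m - T), T)) (?up a) = a" using id[OF g] by (simp add: a chg)
  qed
  show "\<forall>b\<in>?B. ?up ((\<lambda>(I, T). (change_top m I (I m - T), T)) b) = b"
  proof
    fix b assume "b \<in> ?B"
    then obtain I T where b: "b = (I, T)" and g: "geometric_chain \<Phi>p m I" and T: "T \<subseteq> {\<alpha>. indecomposable \<Phi>p m I \<alpha>}" by blast
    have "I m - T \<union> T = I m" using T by (auto simp: indecomposable_def)
    then show "?up ((\<lambda>(I, T). (change_top m I (I m - T), T)) b) = b" using id[OF g] by (simp add: b chg)
  qed
  show "?up ` ?A \<subseteq> ?B"
  proof
    fix b assume "b \<in> ?up ` ?A"
    then obtain I T where b: "b = (change_top m I (I m \<union> T), T)" and g: "geometric_chain \<Phi>p m I"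
      and s: "\<Delta> \<inter> I m = {}" and T: "T \<subseteq> flippable \<Phi>p m I" and n: "card T = n" by auto
    let ?J = "change_top m I (I m \<union> T)"
    have J: "geometric_chain \<Phi>p m ?J" by (rule raise_geometric[OF g m T])
    have "T \<subseteq> {\<alpha>. indecomposable \<Phi>p m ?J \<alpha>}" using indecomposable_raise[OF g m T] by blast
    moreover have "{\<alpha>\<in>\<Delta>. indecomposable \<Phi>p m ?J \<alpha>} \<subseteq> T" using simple_ind[OF J] s by auto
    ultimately show "b \<in> ?B" using J n b by blast
  qed
  show "(\<lambda>(I, T). (change_top m I (I m - T), T)) ` ?B \<subseteq> ?A"
  proof
    fix a assume "a \<in> (\<lambda>(I, T). (change_top m I (I m - T), T)) ` ?B"
    then obtain I T where a: "a = (change_top m I (I m - T), T)" and g: "geometric_chain \<Phi>p m I"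
      and T: "T \<subseteq> {\<alpha>. indecomposable \<Phi>p m I \<alpha>}"
      and s: "{\<alpha>\<in>\<Delta>. indecomposable \<Phi>p m I \<alpha>} \<subseteq> T" and n: "card T = n" by auto
    let ?J = "change_top m I (I m - T)"
    have T': "indecomposable \<Phi>p m I \<alpha>" if "\<alpha> \<in> T" for \<alpha> using T that by blast
    have "geometric_chain \<Phi>p m ?J" by (rule lower_geometric[OF g m T'])
    moreover have "\<Delta> \<inter> ?J m = {}" using simple_ind[OF g] s by auto
    moreover have "T \<subseteq> flippable \<Phi>p m ?J" by (rule flippable_lower[OF g m T'])
    ultimately show "a \<in> ?A" using a n by blast
  qed
qed

end

section \<open>From marked chains to regions with marked walls\<close>

context irreducible_positive_roots
begin

text \<open>The parameter \<open>X\<close> stands for \<open>\<Phi>\<close> when all separating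
  walls are meant and for the simple roots when only the compulsory ones are.\<close>

lemma wall_sets:
  assumes g: "geometric_chain \<Phi>p m I" and m: "m \<ge> 1"
  shows "X \<subseteq> \<Phi> \<Longrightarrow> {H. is_wall \<Phi> m (cell \<Phi>p m I) H \<and> (\<exists>\<alpha>\<in>X. H = hyp \<alpha> (real m)) \<and>
        separates H (cell \<Phi>p m I) (fundamental_alcove \<Phi>p)} =
      (\<lambda>\<alpha>. hyp \<alpha> (real m)) ` {\<alpha>\<in>X. indecomposable \<Phi>p m I \<alpha>}"
    and "{H. is_wall \<Phi> m (cell \<Phi>p m I) H \<and> (\<exists>\<alpha>\<in>\<Phi>. H = hyp \<alpha> (real m)) \<and>
        \<not> separates H (cell \<Phi>p m I) (fundamental_alcove \<Phi>p)} =
      (\<lambda>\<alpha>. hyp \<alpha> (real m)) ` flippable \<Phi>p m I"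
proof -
  show "{H. is_wall \<Phi> m (cell \<Phi>p m I) H \<and> (\<exists>\<alpha>\<in>X. H = hyp \<alpha> (real m)) \<and>
        separates H (cell \<Phi>p m I) (fundamental_alcove \<Phi>p)} =
      (\<lambda>\<alpha>. hyp \<alpha> (real m)) ` {\<alpha>\<in>X. indecomposable \<Phi>p m I \<alpha>}" if X: "X \<subseteq> \<Phi>"
  proof (intro equalityI subsetI)
    fix H assume "H \<in> {H. is_wall \<Phi> m (cell \<Phi>p m I) H \<and> (\<exists>\<alpha>\<in>X. H = hyp \<alpha> (real m)) \<and>
        separates H (cell \<Phi>p m I) (fundamental_alcove \<Phi>p)}"
    then obtain \<alpha> where "\<alpha> \<in> X" "H = hyp \<alpha> (real m)" "is_wall \<Phi> m (cell \<Phi>p m I) (hyp \<alpha> (real m))"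
      "separates (hyp \<alpha> (real m)) (cell \<Phi>p m I) (fundamental_alcove \<Phi>p)" by blast
    then show "H \<in> (\<lambda>\<alpha>. hyp \<alpha> (real m)) ` {\<alpha>\<in>X. indecomposable \<Phi>p m I \<alpha>}"
      using wall_iff(1)[OF g m, of \<alpha>] X by blast
  qed (use wall_iff(1)[OF g m] X in blast)
  show "{H. is_wall \<Phi> m (cell \<Phi>p m I) H \<and> (\<exists>\<alpha>\<in>\<Phi>. H = hyp \<alpha> (real m)) \<and>
        \<not> separates H (cell \<Phi>p m I) (fundamental_alcove \<Phi>p)} =
      (\<lambda>\<alpha>. hyp \<alpha> (real m)) ` flippable \<Phi>p m I"
  proof (intro equalityI subsetI)
    fix H assume "H \<in> {H. is_wall \<Phi> m (cell \<Phi>p m I) H \<and> (\<exists>\<alpha>\<in>\<Phi>. H = hyp \<alpha> (real m)) \<and>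
        \<not> separates H (cell \<Phi>p m I) (fundamental_alcove \<Phi>p)}"
    then obtain \<alpha> where "\<alpha> \<in> \<Phi>" "H = hyp \<alpha> (real m)" "is_wall \<Phi> m (cell \<Phi>p m I) (hyp \<alpha> (real m))"
      "\<not> separates (hyp \<alpha> (real m)) (cell \<Phi>p m I) (fundamental_alcove \<Phi>p)" by blast
    then show "H \<in> (\<lambda>\<alpha>. hyp \<alpha> (real m)) ` flippable \<Phi>p m I"
      using wall_iff(2)[OF g m, of \<alpha>] by blast
  next
    fix H assume "H \<in> (\<lambda>\<alpha>. hyp \<alpha> (real m)) ` flippable \<Phi>p m I"
    then obtain \<alpha> where a: "\<alpha> \<in> flippable \<Phi>p m I" "H = hyp \<alpha> (real m)" by blast
    then have "\<alpha> \<in> \<Phi>" using pos_subset by (auto simp: flippable_def)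
    then show "H \<in> {H. is_wall \<Phi> m (cell \<Phi>p m I) H \<and> (\<exists>\<alpha>\<in>\<Phi>. H = hyp \<alpha> (real m)) \<and>
        \<not> separates H (cell \<Phi>p m I) (fundamental_alcove \<Phi>p)}"
      using wall_iff(2)[OF g m, of \<alpha>] a by blast
  qed
qed

lemma h_plus_eq:
  assumes m: "m \<ge> 1"
  shows "h_plus \<Phi> \<Phi>p m i =
    card {I. geometric_chain \<Phi>p m I \<and> \<Delta> \<inter> I m = {} \<and> card (flippable \<Phi>p m I) = DIM('a) - i}" (is "_ = card ?A")
proof -
  let ?R = "{R \<in> regions \<Phi> m. bounded R \<and> dominant \<Phi>p R \<and>
        card {H. is_wall \<Phi> m R H \<and> (\<exists>\<alpha>\<in>\<Phi>. H = hyp \<alpha> (real m)) \<and>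
                 \<not> separates H R (fundamental_alcove \<Phi>p)} = DIM('a) - i}"
  note bij = bij_betw_cell[of m]
  have inj: "inj_on (cell \<Phi>p m) ?A"
    using bij_betw_imp_inj_on[OF bij] by (rule inj_on_subset) auto
  have cards: "card {H. is_wall \<Phi> m (cell \<Phi>p m I) H \<and> (\<exists>\<alpha>\<in>\<Phi>. H = hyp \<alpha> (real m)) \<and>
                 \<not> separates H (cell \<Phi>p m I) (fundamental_alcove \<Phi>p)} = card (flippable \<Phi>p m I)"
    if "geometric_chain \<Phi>p m I" for I
    unfolding wall_sets(2)[OF that m]
    by (intro card_image inj_on_subset[OF inj_on_hyp[OF m]]) (auto simp: flippable_def)
  have "cell \<Phi>p m ` ?A = ?R"
  proof (intro equalityI subsetI)
    fix R assume "R \<in> cell \<Phi>p m ` ?A"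
    then obtain I where I: "R = cell \<Phi>p m I" "I \<in> ?A" by blast
    then have "R \<in> {R \<in> regions \<Phi> m. dominant \<Phi>p R}" using bij_betwE[OF bij] by blast
    then show "R \<in> ?R" using I cards[of I] bounded_cell_iff[of m I] by simp
  next
    fix R assume R: "R \<in> ?R"
    then have "R \<in> cell \<Phi>p m ` {I. geometric_chain \<Phi>p m I}" using bij_betw_imp_surj_on[OF bij] by blast
    then obtain I where I: "R = cell \<Phi>p m I" "geometric_chain \<Phi>p m I" by blast
    then show "R \<in> cell \<Phi>p m ` ?A" using R cards[of I] bounded_cell_iff[of m I] by simp
  qed
  then show ?thesis unfolding h_plus_def using card_image[OF inj] by simp
qed

lemma f_plus_eq_card:
  assumes m: "m \<ge> 1" and k: "k \<le> DIM('a)"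
  shows "f_plus \<Phi> \<Phi>p m k = int (card {(I, T). geometric_chain \<Phi>p m I \<and> \<Delta> \<inter> I m = {} \<and>
      T \<subseteq> flippable \<Phi>p m I \<and> card T = DIM('a) - k})" (is "_ = int (card ?P)")
proof -
  let ?n = "DIM('a)" and ?F = "\<lambda>I. flippable \<Phi>p m I"
  define B where "B = {I. geometric_chain \<Phi>p m I \<and> \<Delta> \<inter> I m = {}}"
  have finB: "finite B" using finite_geometric_chains[of m] by (rule rev_finite_subset) (auto simp: B_def)
  have finF: "finite (?F I)" for I using finite_roots(2) by (auto simp: flippable_def)
  have P: "?P = Sigma B (\<lambda>I. {T. T \<subseteq> ?F I \<and> card T = ?n - k})" by (auto simp: B_def)
  have "card ?P = (\<Sum>I\<in>B. card (?F I) choose (?n - k))"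
    unfolding P using finB finF by (subst card_SigmaI) (auto simp: n_subsets)
  also have "\<dots> = (\<Sum>i\<le>?n. \<Sum>I\<in>{I\<in>B. ?n - card (?F I) = i}. card (?F I) choose (?n - k))"
    by (rule sum.group[symmetric]) (use finB in auto)
  also have "\<dots> = (\<Sum>i\<le>?n. h_plus \<Phi> \<Phi>p m i * ((?n - i) choose (?n - k)))"
  proof (rule sum.cong)
    fix i assume i: "i \<in> {..?n}"
    \<comment> \<open>The truncated subtraction can be inverted because
      \<open>card_flippable\<close> bounds the cardinality by the rank; so no chain is lost or
      misplaced in the grouping.\<close>
    have eq: "?n - card (?F I) = i \<longleftrightarrow> card (?F I) = ?n - i" for I
      using card_flippable[of m I] i by auto
    have "(\<Sum>I\<in>{I\<in>B. ?n - card (?F I) = i}. card (?F I) choose (?n - k)) =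
        (\<Sum>I\<in>{I\<in>B. card (?F I) = ?n - i}. (?n - i) choose (?n - k))"
      unfolding eq by (rule sum.cong) auto
    also have "\<dots> = h_plus \<Phi> \<Phi>p m i * ((?n - i) choose (?n - k))"
      unfolding h_plus_eq[OF m] by (simp add: B_def conj_assoc)
    finally show "(\<Sum>I\<in>{I\<in>B. ?n - card (?F I) = i}. card (?F I) choose (?n - k)) =
        h_plus \<Phi> \<Phi>p m i * ((?n - i) choose (?n - k))" .
  qed simp
  finally show ?thesis unfolding f_plus_eq[OF k] by simp
qed

text \<open>\<open>(I, T)\<close> corresponds to the cell of \<open>I\<close> with the hyperplanes
  of \<open>T\<close>. Distinct positive roots have distinct hyperplanes at level
  \<open>m \<ge> 1\<close>, so cardinalities and inclusions carry over both ways.\<close>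

lemma card_region_wall_pairs:
  assumes m: "m \<ge> 1"
  shows "card {(R, S). R \<in> regions \<Phi> m \<and> dominant \<Phi>p R \<and>
        S \<subseteq> {H. is_wall \<Phi> m R H \<and> (\<exists>\<alpha>\<in>\<Phi>. H = hyp \<alpha> (real m)) \<and>
                 separates H R (fundamental_alcove \<Phi>p)} \<and>
        card S = n \<and>
        {H. is_wall \<Phi> m R H \<and> (\<exists>\<alpha>\<in>\<Delta>. H = hyp \<alpha> (real m)) \<and>
            separates H R (fundamental_alcove \<Phi>p)} \<subseteq> S} =
    card {(I, T). geometric_chain \<Phi>p m I \<and> T \<subseteq> {\<alpha>. indecomposable \<Phi>p m I \<alpha>} \<and> card T = n \<and>
        {\<alpha>\<in>\<Delta>. indecomposable \<Phi>p m I \<alpha>} \<subseteq> T}" (is "card ?P = card ?Q")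
proof -
  let ?h = "\<lambda>\<alpha>. hyp \<alpha> (real m)"
  define \<phi> :: "(nat \<Rightarrow> 'a set) \<times> 'a set \<Rightarrow> 'a set \<times> 'a set set" where "\<phi> = (\<lambda>(I, T). (cell \<Phi>p m I, ?h ` T))"
  note bij = bij_betw_cell[of m]
  have ind: "{\<alpha>. indecomposable \<Phi>p m I \<alpha>} \<subseteq> \<Phi>p" if "geometric_chain \<Phi>p m I" for I
    using geometric_chainD(2)[OF that] by (auto simp: indecomposable_def)
  have ind': "{\<alpha>\<in>\<Phi>. indecomposable \<Phi>p m I \<alpha>} = {\<alpha>. indecomposable \<Phi>p m I \<alpha>}" if "geometric_chain \<Phi>p m I" for I
    using ind[OF that] pos_subset by blast
  have \<Delta>: "\<Delta> \<subseteq> \<Phi>" using simple_subset pos_subset by blast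
  note hinj = inj_on_hyp[OF m]
  have inj: "inj_on \<phi> ?Q"
  proof (rule inj_onI, clarify)
    fix I T I' T'
    assume g: "geometric_chain \<Phi>p m I" "geometric_chain \<Phi>p m I'"
      and T: "T \<subseteq> {\<alpha>. indecomposable \<Phi>p m I \<alpha>}" "T' \<subseteq> {\<alpha>. indecomposable \<Phi>p m I' \<alpha>}"
      and eq: "\<phi> (I, T) = \<phi> (I', T')"
    have "I = I'" using eq g bij_betw_imp_inj_on[OF bij] by (auto simp: \<phi>_def inj_on_def)
    moreover have "T = T'"
      using eq T ind[OF g(1)] ind[OF g(2)] inj_on_image_eq_iff[OF hinj, of T T'] by (auto simp: \<phi>_def)
    ultimately show "I = I' \<and> T = T'" by blast
  qed
  have img: "\<phi> ` ?Q = ?P"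
  proof (intro equalityI subsetI)
    fix p assume "p \<in> \<phi> ` ?Q"
    then obtain I T where p: "p = (cell \<Phi>p m I, ?h ` T)" and g: "geometric_chain \<Phi>p m I"
      and T: "T \<subseteq> {\<alpha>. indecomposable \<Phi>p m I \<alpha>}" "card T = n" "{\<alpha>\<in>\<Delta>. indecomposable \<Phi>p m I \<alpha>} \<subseteq> T"
      by (auto simp: \<phi>_def)
    have "card (?h ` T) = n" using T(2) card_image[OF inj_on_subset[OF hinj]] T(1) ind[OF g] by blast
    moreover have "cell \<Phi>p m I \<in> {R \<in> regions \<Phi> m. dominant \<Phi>p R}" using bij_betwE[OF bij] g by blast
    ultimately show "p \<in> ?P" unfolding p
      using T image_mono[OF T(1), of ?h] image_mono[OF T(3), of ?h]
      by (simp add: wall_sets(1)[OF g m order_refl] wall_sets(1)[OF g m \<Delta>] ind'[OF g])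
  next
    fix p assume "p \<in> ?P"
    then obtain R S where p: "p = (R, S)" and R: "R \<in> regions \<Phi> m" "dominant \<Phi>p R"
      and S: "S \<subseteq> {H. is_wall \<Phi> m R H \<and> (\<exists>\<alpha>\<in>\<Phi>. H = hyp \<alpha> (real m)) \<and> separates H R (fundamental_alcove \<Phi>p)}"
        "card S = n" "{H. is_wall \<Phi> m R H \<and> (\<exists>\<alpha>\<in>\<Delta>. H = hyp \<alpha> (real m)) \<and>
            separates H R (fundamental_alcove \<Phi>p)} \<subseteq> S" by blast
    have "R \<in> cell \<Phi>p m ` {I. geometric_chain \<Phi>p m I}" using bij_betw_imp_surj_on[OF bij] R by blast
    then obtain I where g: "geometric_chain \<Phi>p m I" and RI: "R = cell \<Phi>p m I" by blast
    have "S \<subseteq> ?h ` {\<alpha>. indecomposable \<Phi>p m I \<alpha>}"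
      using S(1) unfolding RI wall_sets(1)[OF g m order_refl] ind'[OF g] .
    then obtain T where T: "T \<subseteq> {\<alpha>. indecomposable \<Phi>p m I \<alpha>}" "S = ?h ` T" by (meson subset_imageE)
    have TP: "T \<subseteq> \<Phi>p" using T(1) ind[OF g] by blast
    have "?h ` {\<alpha>\<in>\<Delta>. indecomposable \<Phi>p m I \<alpha>} \<subseteq> ?h ` T"
      using S(3) unfolding RI wall_sets(1)[OF g m \<Delta>] T(2) .
    then have "{\<alpha>\<in>\<Delta>. indecomposable \<Phi>p m I \<alpha>} \<subseteq> T"
      by (subst (asm) inj_on_image_subset_iff[OF hinj _ TP]) (use simple_subset in blast)
    moreover have "card T = n" using S(2) T(2) card_image[OF inj_on_subset[OF hinj TP]] by simp
    ultimately have "(I, T) \<in> ?Q" using g T(1) by blast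
    moreover have "p = \<phi> (I, T)" using p RI T(2) by (simp add: \<phi>_def)
    ultimately show "p \<in> \<phi> ` ?Q" by blast
  qed
  show ?thesis using card_image[OF inj] unfolding img .
qed

end

theorem theorem5p6:
  fixes \<Phi> \<Phi>p :: "'a::euclidean_space set" and m k :: nat
  assumes "irreducible_root_system \<Phi>"
    and "positive_system \<Phi> \<Phi>p"
    and "m \<ge> 1" and "k \<le> DIM('a)"
  shows "f_plus \<Phi> \<Phi>p m k =
           int (card {(R, S). R \<in> regions \<Phi> m \<and> dominant \<Phi>p R \<and>
              S \<subseteq> {H. is_wall \<Phi> m R H \<and> (\<exists>\<alpha>\<in>\<Phi>. H = hyp \<alpha> (real m)) \<and>
                       separates H R (fundamental_alcove \<Phi>p)} \<and>
              card S = DIM('a) - k \<and>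
              {H. is_wall \<Phi> m R H \<and> (\<exists>\<alpha>\<in>simple_roots \<Phi>p. H = hyp \<alpha> (real m)) \<and>
                  separates H R (fundamental_alcove \<Phi>p)} \<subseteq> S})
       \<and> f_plus \<Phi> \<Phi>p m k =
           int (card {(I, T). geometric_chain \<Phi>p m I \<and>
              T \<subseteq> {\<alpha>. indecomposable \<Phi>p m I \<alpha>} \<and>
              card T = DIM('a) - k \<and>
              {\<alpha>\<in>simple_roots \<Phi>p. indecomposable \<Phi>p m I \<alpha>} \<subseteq> T})"
proof -
  obtain v where v: "\<forall>\<alpha>\<in>\<Phi>. inner v \<alpha> \<noteq> 0" "\<Phi>p = {\<alpha>\<in>\<Phi>. inner v \<alpha> > 0}"
    using assms(2) by (auto simp: positive_system_def)
  interpret irreducible_positive_roots \<Phi> \<Phi>p v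
  proof
    show "crystallographic_root_system \<Phi>" using assms(1) by (simp add: irreducible_root_system_def)
    show "inner v \<alpha> \<noteq> 0" if "\<alpha> \<in> \<Phi>" for \<alpha> using v(1) that by blast
  qed (rule v(2), rule assms(1))
  have "f_plus \<Phi> \<Phi>p m k =
      int (card {(I, T). geometric_chain \<Phi>p m I \<and> T \<subseteq> {\<alpha>. indecomposable \<Phi>p m I \<alpha>} \<and>
              card T = DIM('a) - k \<and> {\<alpha>\<in>simple_roots \<Phi>p. indecomposable \<Phi>p m I \<alpha>} \<subseteq> T})"
    unfolding f_plus_eq_card[OF assms(3,4)] bij_betw_same_card[OF bij_betw_raise[OF assms(3)]] ..
  then show ?thesis unfolding card_region_wall_pairs[OF assms(3)] by simp
qed

end
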